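(* Let $n\ge 3$, let $K$ be a field, let $X=(x_{ij})_{1\le i,j\le n}$ and $Y=(y_{ij})_{1\le i,j\le n}$ be matrices of independent indeterminates over $K$, let $R=K[X,Y]$ be the polynomial ring in all these $2n^2$ variables, and let $C=XY-YX=(c_{ij})$. Let $J$ be the ideal of $R$ generated by the anti-diagonal entries $c_{i,n+1-i}$ ($1\le i\le n$) of $C$. Then the elements $$x_{ij}\quad\text{where }2\le i\le n,\ 1\le j\le n,$$ $$y_{ij}\quad\text{where }1\le i\le n,\ 2\le j\le n,$$ $$x_{1j}-y_{n-j+1,1}\quad\text{where }1\le j\le n,$$ form a homogeneous system of parameters and a regular sequence on $R/J$.
   Context: $R$ is graded by total degree with all variables of degree $1$. A homogeneous system of parameters for a quotient $R/\mathfrak a$ by a homogeneous ideal $\mathfrak a$ is a sequence of $\dim(R/\mathfrak a)$ homogeneous elements of positive degree such that the quotient of $R/\mathfrak a$ by the ideal they generate has Krull dimension $0$. *)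

theory Defs
  imports
    "HOL-Library.Poly_Mapping"
    "HOL-Library.Extended_Real"
    "HOL-Algebra.QuotRing"
    "Jordan_Normal_Form.Matrix"
begin

text \<open>
  The Krull dimension is the supremum of the lengths \<open>k\<close> of strict chains
  \<open>P 0 \<subset> \<dots> \<subset> P k\<close> of prime ideals. It takes values in the extended reals, so that a ring
  without prime ideals (the zero ring) has dimension \<open>- \<infinity>\<close> and not \<open>0\<close>.
\<close>

definition krull_dim :: "('a, 'b) ring_scheme \<Rightarrow> ereal" where
  "krull_dim A = Sup {ereal (real k) | k.
     \<exists>P. (\<forall>i\<le>k. primeideal (P i) A) \<and> (\<forall>i<k. P i \<subset> P (Suc i))}"

definition nonzerodivisor :: "('a, 'b) ring_scheme \<Rightarrow> 'a \<Rightarrow> bool" where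
  "nonzerodivisor A a \<longleftrightarrow>
     a \<in> carrier A \<and> (\<forall>b\<in>carrier A. a \<otimes>\<^bsub>A\<^esub> b = \<zero>\<^bsub>A\<^esub> \<longrightarrow> b = \<zero>\<^bsub>A\<^esub>)"

definition regular_sequence :: "('a, 'b) ring_scheme \<Rightarrow> 'a list \<Rightarrow> bool" where
  "regular_sequence A fs \<longleftrightarrow>
     set fs \<subseteq> carrier A \<and>
     (\<forall>i<length fs.
        let I = genideal A (set (take i fs))
        in nonzerodivisor (A Quot I) (I +>\<^bsub>A\<^esub> (fs ! i))) \<and>
     genideal A (set fs) \<noteq> carrier A"

text \<open>
  Monomials are finitely supported exponent functions \<open>'v \<Rightarrow>\<^sub>0 nat\<close>; the product of
  \<^typ>\<open>('v \<Rightarrow>\<^sub>0 nat) \<Rightarrow>\<^sub>0 'k\<close> is the convolution product, that is, multiplication of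
  polynomials. The ring below consists of the polynomials in the variables from \<open>V\<close> only.
\<close>

type_synonym ('v, 'k) mpoly = "('v \<Rightarrow>\<^sub>0 nat) \<Rightarrow>\<^sub>0 'k"

definition poly_ring :: "'v set \<Rightarrow> ('v, 'k::field) mpoly ring" where
  "poly_ring V =
     \<lparr>carrier = {p. \<forall>m\<in>Poly_Mapping.keys p. Poly_Mapping.keys m \<subseteq> V}, monoid.mult = (*), one = 1, zero = 0, add = (+)\<rparr>"

definition indet :: "'v \<Rightarrow> ('v, 'k::field) mpoly" where
  "indet v = Poly_Mapping.single (Poly_Mapping.single v 1) 1"

definition total_degree :: "('v \<Rightarrow>\<^sub>0 nat) \<Rightarrow> nat" where
  "total_degree m = (\<Sum>v\<in>Poly_Mapping.keys m. Poly_Mapping.lookup m v)"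

definition homogeneous :: "nat \<Rightarrow> ('v, 'k::field) mpoly \<Rightarrow> bool" where
  "homogeneous d p \<longleftrightarrow> (\<forall>m\<in>Poly_Mapping.keys p. total_degree m = d)"

definition homogeneous_ideal :: "'v set \<Rightarrow> ('v, 'k::field) mpoly set \<Rightarrow> bool" where
  "homogeneous_ideal V I \<longleftrightarrow>
     (\<exists>S. S \<subseteq> carrier (poly_ring V) \<and> (\<forall>p\<in>S. \<exists>d. homogeneous d p) \<and>
          I = genideal (poly_ring V) S)"

text \<open>
  Here \<open>gs\<close> is a list of elements of the quotient ring, i.e. of cosets of \<open>I\<close>; a coset is
  homogeneous of degree \<open>d\<close> if it is the class of a homogeneous polynomial of degree \<open>d\<close>.
\<close>

definition hsop :: "'v set \<Rightarrow> ('v, 'k::field) mpoly set \<Rightarrow> ('v, 'k) mpoly set list \<Rightarrow> bool" where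
  "hsop V I gs \<longleftrightarrow>
     (let R = poly_ring V; A = R Quot I in
        homogeneous_ideal V I \<and>
        (\<forall>g\<in>set gs. \<exists>d>0. \<exists>p\<in>carrier R. homogeneous d p \<and> g = I +>\<^bsub>R\<^esub> p) \<and>
        krull_dim A = ereal (real (length gs)) \<and>
        krull_dim (A Quot genideal A (set gs)) = 0)"

datatype mvar = XVar nat nat | YVar nat nat

definition mvars :: "nat \<Rightarrow> mvar set" where
  "mvars n = {XVar i j | i j. i \<in> {1..n} \<and> j \<in> {1..n}} \<union>
             {YVar i j | i j. i \<in> {1..n} \<and> j \<in> {1..n}}"

abbreviation xvar :: "nat \<Rightarrow> nat \<Rightarrow> (mvar, 'k::field) mpoly" where
  "xvar i j \<equiv> indet (XVar i j)"

abbreviation yvar :: "nat \<Rightarrow> nat \<Rightarrow> (mvar, 'k::field) mpoly" where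
  "yvar i j \<equiv> indet (YVar i j)"

text \<open>The indeterminates are indexed from 1, whereas entries of type \<^typ>\<open>'a mat\<close> are indexed
  from 0.\<close>

definition generic_X :: "nat \<Rightarrow> (mvar, 'k::field) mpoly mat" where
  "generic_X n = mat n n (\<lambda>(i, j). xvar (i + 1) (j + 1))"

definition generic_Y :: "nat \<Rightarrow> (mvar, 'k::field) mpoly mat" where
  "generic_Y n = mat n n (\<lambda>(i, j). yvar (i + 1) (j + 1))"

definition commutator :: "nat \<Rightarrow> (mvar, 'k::field) mpoly mat" where
  "commutator n = generic_X n * generic_Y n - generic_Y n * generic_X n"

definition comm_entry :: "nat \<Rightarrow> nat \<Rightarrow> nat \<Rightarrow> (mvar, 'k::field) mpoly" where
  "comm_entry n i j = commutator n $$ (i - 1, j - 1)"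

definition antidiag_ideal :: "nat \<Rightarrow> (mvar, 'k::field) mpoly set" where
  "antidiag_ideal n = genideal (poly_ring (mvars n)) {comm_entry n i (n + 1 - i) | i. i \<in> {1..n}}"

definition parameters :: "nat \<Rightarrow> (mvar, 'k::field) mpoly set" where
  "parameters n =
     {xvar i j | i j. i \<in> {2..n} \<and> j \<in> {1..n}} \<union>
     {yvar i j | i j. i \<in> {1..n} \<and> j \<in> {2..n}} \<union>
     {xvar 1 j - yvar (n - j + 1) 1 | j. j \<in> {1..n}}"

end

theory Submission
  imports Defs "HOL-Algebra.Ring_Divisibility"
begin

text \<open>
Write \<open>i' = n + 1 - i\<close>. The variables split into the first column
\<open>z\<^sub>i = y\<^sub>i\<^sub>1\<close> of \<open>Y\<close> and the others; the parameters are the other variables, except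
that \<open>x\<^sub>1\<^sub>j\<close> is replaced by \<open>x\<^sub>1\<^sub>j - z\<close> for the matching \<open>z\<close>. Thus parameters and \<open>z\<close>'s
together are linear coordinates of \<open>K[X,Y]\<close>. In the entry of \<open>C\<close> at \<open>(i, i')\<close> the only product of
two variables that both survive modulo the parameters is \<open>- y\<^sub>i\<^sub>1 x\<^sub>1\<^sub>i'\<close>, and it becomes \<open>- z\<^sub>i\<^sup>2\<close>.
So the negated entries are \<open>c\<^sub>i = z\<^sub>i\<^sup>2 + \<Sum> (parameter \<sqdot> linear form)\<close>: a system of quadrics that is
monic in the \<open>z\<close>'s over the polynomial ring \<open>S\<close> in the parameters.

For every such system the products \<open>\<pi>\<^sup>a c\<^sup>e z\<^sup>\<epsilon>\<close> with \<open>\<epsilon>\<^sub>i \<in> {0, 1}\<close> form a \<open>K\<close>-basis of the polynomial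
ring. They span because \<open>z\<^sup>2\<close> can be replaced by \<open>c\<close> at the cost of terms that contain a parameter
(\<open>polys_le_subset_span_adapted\<close>), and they are independent because there are as many of them as
monomials in each bounded degree (\<open>independent_adapted\<close>). Sending the monomial \<open>\<pi>\<^sup>a z\<^sup>m\<close> to
\<open>\<pi>\<^sup>a c\<^sup>e z\<^sup>\<epsilon>\<close> with \<open>m = 2e + \<epsilon>\<close> is therefore a bijection, \<open>expand\<close>. It turns multiplication by a
variable into multiplication by its parameter, and it carries the monomial ideal generated by the
\<open>z\<^sub>i\<^sup>2\<close> and some variables onto the ideal generated by the \<open>c\<^sub>i\<close> and the corresponding parameters
(\<open>genideal_relations_eq\<close>). In other words, the quotient by the \<open>c\<^sub>i\<close> is a free \<open>S\<close>-module on the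
squarefree monomials in \<open>z\<close>. Regularity of the parameters, in any order, is now a statement about
supports of monomials (\<open>param_nonzerodivisor\<close>).

Both dimensions follow from two bounds. A regular sequence of length \<open>N\<close> that generates a proper ideal
gives a chain of \<open>N + 1\<close> primes, since a prime that contains an element regular modulo a smaller ideal
has a strictly smaller prime above that ideal (\<open>krull_dim_ge_length_regular_sequence\<close>). Conversely, if
\<open>N\<close> parameters are not killed, then the residue classes of polynomials of degree at most \<open>d\<close> span a
space of dimension \<open>O(d\<^sup>N)\<close>, hence any \<open>N + 1\<close> elements are algebraically dependent. Along a strict
chain of primes \<open>P\<^sub>0 \<subset> \<dots> \<subset> P\<^sub>N\<^sub>+\<^sub>1\<close> elements \<open>x\<^sub>i \<in> P\<^sub>i\<^sub>+\<^sub>1 - P\<^sub>i\<close> are algebraically independent modulo \<open>P\<^sub>0\<close>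
(\<open>relation_notin_bottom_of_chain\<close>), so no such chain exists (\<open>chain_length_le\<close>).
\<close>

section \<open>Krull dimension in commutative rings\<close>

text \<open>
Krull's lemma: an ideal that is maximal among those disjoint from a multiplicative set is prime. If
neither \<open>a\<close> nor \<open>b\<close> lies in it, adjoining either one reaches the set, and the product of the two
elements reached differs from a multiple of \<open>a \<otimes> b\<close> by an element of the ideal.
\<close>

lemma (in cring) exists_primeideal_disjoint:
  assumes I: "ideal I R" and M: "M \<subseteq> carrier R" "\<one> \<in> M" "\<And>a b. a \<in> M \<Longrightarrow> b \<in> M \<Longrightarrow> a \<otimes> b \<in> M"
    and disj: "I \<inter> M = {}"
  shows "\<exists>Q. primeideal Q R \<and> I \<subseteq> Q \<and> Q \<inter> M = {}"
proof -
  define \<A> where "\<A> = {Q. ideal Q R \<and> I \<subseteq> Q \<and> Q \<inter> M = {}}"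
  have "\<exists>Q\<in>\<A>. \<forall>X\<in>\<A>. Q \<subseteq> X \<longrightarrow> X = Q"
  proof (rule subset_Zorn_nonempty)
    show "\<A> \<noteq> {}" using I disj unfolding \<A>_def by auto
  next
    fix C assume C: "C \<noteq> {}" "subset.chain \<A> C"
    then have "C \<subseteq> \<A>" unfolding pred_on.chain_def by auto
    have "subset.chain {I. ideal I R} C"
      using C(2) unfolding pred_on.chain_def \<A>_def by auto
    from chain_Union_is_ideal[OF this] have "ideal (\<Union> C) R" using C(1) by simp
    moreover have "I \<subseteq> \<Union> C" using C(1) \<open>C \<subseteq> \<A>\<close> unfolding \<A>_def by auto
    moreover have "\<Union> C \<inter> M = {}" using \<open>C \<subseteq> \<A>\<close> unfolding \<A>_def by auto
    ultimately show "\<Union> C \<in> \<A>" unfolding \<A>_def by auto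
  qed
  then obtain Q where QA: "Q \<in> \<A>" and maxA: "\<forall>X\<in>\<A>. Q \<subseteq> X \<longrightarrow> X = Q" by (rule bexE)
  have Q: "ideal Q R" "I \<subseteq> Q" "Q \<inter> M = {}" using QA unfolding \<A>_def by auto
  have max: "X = Q" if "ideal X R" "Q \<subseteq> X" "X \<inter> M = {}" for X
  proof -
    have "X \<in> \<A>" using that Q(2) unfolding \<A>_def by auto
    then show ?thesis using maxA that(2) by simp
  qed
  interpret Q: ideal Q R by fact
  have meets: "\<exists>q\<in>Q. \<exists>r\<in>carrier R. q \<oplus> r \<otimes> a \<in> M" if a: "a \<in> carrier R" "a \<notin> Q" for a
  proof -
    define X where "X = Q <+>\<^bsub>R\<^esub> PIdl a"
    have X: "ideal X R" unfolding X_def by (intro add_ideals Q cgenideal_ideal a)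
    have mem: "q \<oplus> r \<otimes> a \<in> X" if "q \<in> Q" "r \<in> carrier R" for q r
      using that unfolding X_def set_add_def' cgenideal_def by auto
    have "Q \<subseteq> X"
    proof
      fix q assume "q \<in> Q"
      then show "q \<in> X" using mem[of q \<zero>] a by (simp add: Q.Icarr)
    qed
    moreover have "a \<in> X" using mem[of \<zero> \<one>] a by simp
    ultimately have "X \<inter> M \<noteq> {}" using max X a(2) by blast
    then obtain m where "m \<in> X" "m \<in> M" by auto
    then show ?thesis unfolding X_def set_add_def' cgenideal_def by auto
  qed
  have "primeideal Q R"
  proof (rule primeidealI[OF Q(1)])
    show "cring R" by (rule is_cring)
    show "carrier R \<noteq> Q" using Q(3) M by blast
    fix a b assume ab: "a \<in> carrier R" "b \<in> carrier R" "a \<otimes> b \<in> Q"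
    show "a \<in> Q \<or> b \<in> Q"
    proof (rule ccontr)
      assume "\<not> (a \<in> Q \<or> b \<in> Q)"
      then obtain q r q' r' where q: "q \<in> Q" "r \<in> carrier R" "q \<oplus> r \<otimes> a \<in> M"
        "q' \<in> Q" "r' \<in> carrier R" "q' \<oplus> r' \<otimes> b \<in> M"
        using meets ab by meson
      then have "(q \<oplus> r \<otimes> a) \<otimes> (q' \<oplus> r' \<otimes> b) \<in> M" using M by blast
      moreover have qc: "q \<in> carrier R" "q' \<in> carrier R" using q Q.Icarr by auto
      moreover have "(q \<oplus> r \<otimes> a) \<otimes> (q' \<oplus> r' \<otimes> b)
        = q \<otimes> (q' \<oplus> r' \<otimes> b) \<oplus> ((r \<otimes> a) \<otimes> q' \<oplus> (r \<otimes> r') \<otimes> (a \<otimes> b))"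
        using ab q(2,5) qc by algebra
      moreover have "\<dots> \<in> Q"
        using ab q qc
        by (intro Q.a_closed[OF Q.I_r_closed[OF q(1)]
              Q.a_closed[OF Q.I_l_closed[OF q(4)] Q.I_l_closed[OF ab(3)]]]) auto
      ultimately show False using Q(3) by auto
    qed
  qed
  then show ?thesis using Q by auto
qed

text \<open>
Apply Krull's lemma to the multiplicative set of all \<open>s a\<^sup>k\<close> with \<open>s \<notin> P\<close>. It misses \<open>I\<close>, because
\<open>s a\<^sup>k \<in> I\<close> would give \<open>s \<in> I \<subseteq> P\<close> by cancelling \<open>a\<close>. A prime disjoint from this set lies
inside \<open>P\<close> (take \<open>k = 0\<close>) and does not contain \<open>a\<close> (take \<open>s = 1\<close>).
\<close>

lemma (in cring) smaller_primeideal_avoiding_nonzerodivisor: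
  assumes I: "ideal I R" and P: "primeideal P R" "I \<subseteq> P" and a: "a \<in> P"
    and nzd: "\<And>b. b \<in> carrier R \<Longrightarrow> a \<otimes> b \<in> I \<Longrightarrow> b \<in> I"
  shows "\<exists>Q. primeideal Q R \<and> I \<subseteq> Q \<and> Q \<subset> P"
proof -
  interpret P: primeideal P R by fact
  have ac: "a \<in> carrier R" using a P.Icarr by auto
  define M where "M = {s \<otimes> a [^] k | s (k::nat). s \<in> carrier R - P}"
  have M_carrier: "M \<subseteq> carrier R" unfolding M_def using ac by auto
  have nzd_pow: "b \<in> I" if "b \<in> carrier R" "b \<otimes> a [^] k \<in> I" for b and k :: nat
    using that
  proof (induction k)
    case (Suc k)
    have "a \<otimes> (b \<otimes> a [^] k) = b \<otimes> a [^] Suc k" using Suc.prems ac by (simp add: m_ac)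
    then show ?case using Suc nzd[of "b \<otimes> a [^] k"] ac by auto
  qed auto
  have one: "\<one> \<in> carrier R - P" using P.I_notcarr P.one_imp_carrier by auto
  have memM: "s \<otimes> a [^] k \<in> M" if "s \<in> carrier R - P" for s and k :: nat
    using that unfolding M_def by blast
  have "\<exists>Q. primeideal Q R \<and> I \<subseteq> Q \<and> Q \<inter> M = {}"
  proof (rule exists_primeideal_disjoint[OF I M_carrier])
    show "\<one> \<in> M" using memM[OF one, of 0] by simp
    show "I \<inter> M = {}" using nzd_pow P(2) unfolding M_def by blast
    fix x y assume "x \<in> M" "y \<in> M"
    then obtain s t k l where st: "s \<in> carrier R - P" "t \<in> carrier R - P"
      "x = s \<otimes> a [^] (k::nat)" "y = t \<otimes> a [^] (l::nat)" unfolding M_def by blast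
    have "(s \<otimes> t) \<otimes> a [^] (k + l) = x \<otimes> y"
      using st ac by (simp add: nat_pow_mult[symmetric] m_ac)
    moreover have "s \<otimes> t \<in> carrier R - P" using st P.I_prime by auto
    ultimately show "x \<otimes> y \<in> M" using memM[of "s \<otimes> t" "k + l"] by simp
  qed
  then obtain Q where Q: "primeideal Q R" "I \<subseteq> Q" "Q \<inter> M = {}" by blast
  interpret Q: primeideal Q R by fact
  have "Q \<subseteq> P"
  proof
    fix s assume s: "s \<in> Q"
    then show "s \<in> P" using memM[of s 0] Q(3) Q.Icarr by fastforce
  qed
  moreover have "a \<notin> Q" using memM[OF one, of 1] Q(3) ac by auto
  ultimately show ?thesis using Q a by blast
qed

lemma (in ideal) rcos_eq_iff:
  assumes "a \<in> carrier R" "b \<in> carrier R"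
  shows "I +> a = I +> b \<longleftrightarrow> a \<ominus> b \<in> I"
  using quotient_eq_iff_same_a_r_cos[OF is_ideal assms] by auto

lemma (in ideal) rcos_eq_self_iff:
  assumes "a \<in> carrier R"
  shows "I +> a = I \<longleftrightarrow> a \<in> I"
  using assms a_rcos_zero[OF is_ideal] rcos_const_imp_mem is_ideal by blast

lemma zero_FactRing: "\<zero>\<^bsub>R Quot I\<^esub> = I"
  by (simp add: FactRing_def)

lemma (in ideal) rcos_mult_mem_iff:
  assumes "a \<in> carrier R" "b \<in> carrier R"
  shows "(I +> a) \<otimes>\<^bsub>R Quot I\<^esub> (I +> b) = \<zero>\<^bsub>R Quot I\<^esub> \<longleftrightarrow> a \<otimes> b \<in> I"
proof -
  have "(I +> a) \<otimes>\<^bsub>R Quot I\<^esub> (I +> b) = I +> (a \<otimes> b)"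
    using ring_hom_mult[OF rcos_ring_hom assms] by simp
  then show ?thesis using assms rcos_eq_self_iff[of "a \<otimes> b"] by (simp add: zero_FactRing)
qed

lemma carrier_FactRing: "carrier (R Quot I) = (\<lambda>a. I +>\<^bsub>R\<^esub> a) ` carrier R"
  unfolding FactRing_def A_RCOSETS_def' by auto

lemma (in ideal) nonzerodivisor_Quot_iff:
  assumes "a \<in> carrier R"
  shows "nonzerodivisor (R Quot I) (I +> a) \<longleftrightarrow> (\<forall>b\<in>carrier R. a \<otimes> b \<in> I \<longrightarrow> b \<in> I)"
proof -
  have "I +> a \<in> carrier (R Quot I)" using assms by (simp add: carrier_FactRing)
  moreover have "I +> b = \<zero>\<^bsub>R Quot I\<^esub> \<longleftrightarrow> b \<in> I" if "b \<in> carrier R" for b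
    using rcos_eq_self_iff[OF that] by (simp add: zero_FactRing)
  ultimately show ?thesis
    using rcos_mult_mem_iff[OF assms]
    unfolding nonzerodivisor_def by (simp add: carrier_FactRing)
qed

text \<open>
The chain is built downwards, starting at a prime above all of \<open>fs\<close>; dropping the last element of the
sequence allows one more strictly smaller prime below.
\<close>

lemma (in cring) krull_dim_ge_length_regular_sequence:
  assumes "regular_sequence R fs"
  shows "krull_dim R \<ge> ereal (real (length fs))"
proof -
  let ?I = "\<lambda>i. Idl (set (take i fs))"
  have fs: "set fs \<subseteq> carrier R" using assms unfolding regular_sequence_def by auto
  then have sub: "set (take i fs) \<subseteq> carrier R" for i using set_take_subset[of i fs] by auto
  have I: "ideal (?I i) R" for i by (rule genideal_ideal[OF sub])
  have chain: "\<exists>P. (\<forall>i\<le>k. primeideal (P i) R) \<and> (\<forall>i<k. P i \<subset> P (Suc i)) \<and> ?I (length fs - k) \<subseteq> P 0"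
    if "k \<le> length fs" for k
    using that
  proof (induction k)
    case 0
    have "?I (length fs) \<inter> {\<one>} = {}"
      using assms ideal.one_imp_carrier[OF I[of "length fs"]]
      unfolding regular_sequence_def by auto
    then obtain Q where "primeideal Q R" "?I (length fs) \<subseteq> Q"
      using exists_primeideal_disjoint[OF I, of "{\<one>}"] by fastforce
    then show ?case by auto
  next
    case (Suc k)
    then obtain P where P: "\<And>i. i \<le> k \<Longrightarrow> primeideal (P i) R" "\<And>i. i < k \<Longrightarrow> P i \<subset> P (Suc i)"
      "?I (length fs - k) \<subseteq> P (0::nat)" by auto
    define j where "j = length fs - Suc k"
    have j: "j < length fs" "length fs - k = Suc j" using Suc.prems unfolding j_def by auto
    have fj: "fs ! j \<in> carrier R" using fs j by auto
    have "nonzerodivisor (R Quot ?I j) (?I j +> fs ! j)"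
      using assms j unfolding regular_sequence_def by (auto simp: Let_def)
    then have nzd: "\<And>b. b \<in> carrier R \<Longrightarrow> fs ! j \<otimes> b \<in> ?I j \<Longrightarrow> b \<in> ?I j"
      using ideal.nonzerodivisor_Quot_iff[OF I fj] by auto
    have step: "set (take (Suc j) fs) = insert (fs ! j) (set (take j fs))"
      using j by (simp add: take_Suc_conv_app_nth)
    have gen: "set (take (Suc j) fs) \<subseteq> P 0"
      using genideal_self[OF sub[of "Suc j"]] P(3) j by auto
    then have "?I j \<subseteq> P 0"
      using P(1)[of 0] step by (intro genideal_minimal) (auto dest: primeideal.axioms(1))
    moreover have "fs ! j \<in> P 0" using gen step by auto
    ultimately have "\<exists>Q. primeideal Q R \<and> ?I j \<subseteq> Q \<and> Q \<subset> P 0"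
      using P(1)[of 0] nzd by (intro smaller_primeideal_avoiding_nonzerodivisor[OF I]) auto
    then obtain Q where Q: "primeideal Q R" "?I j \<subseteq> Q" "Q \<subset> P 0" by (elim exE conjE)
    let ?P = "\<lambda>i. case i of 0 \<Rightarrow> Q | Suc i \<Rightarrow> P i"
    have "\<forall>i\<le>Suc k. primeideal (?P i) R" "\<forall>i<Suc k. ?P i \<subset> ?P (Suc i)" "?I j \<subseteq> ?P 0"
      using P Q by (auto split: nat.split)
    then show ?case unfolding j_def by (intro exI[of _ ?P] conjI)
  qed
  show ?thesis unfolding krull_dim_def
    by (rule Sup_upper) (use chain[of "length fs"] in auto)
qed

lemma (in cring) krull_dim_Quot_nonneg:
  assumes I: "ideal I R" and proper: "\<one> \<notin> I"
  shows "krull_dim (R Quot I) \<ge> 0"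
proof -
  interpret I: ideal I R by (rule I)
  interpret Q: cring "R Quot I" by (rule I.quotient_is_cring[OF is_cring])
  have "genideal (R Quot I) {} \<subseteq> {\<zero>\<^bsub>R Quot I\<^esub>}" by (rule Q.genideal_minimal[OF Q.zeroideal]) simp
  moreover have "I +> \<one> \<noteq> \<zero>\<^bsub>R Quot I\<^esub>"
    using proper I.rcos_eq_self_iff[of \<one>] by (simp add: zero_FactRing)
  moreover have "I +> \<one> \<in> carrier (R Quot I)" by (simp add: carrier_FactRing)
  ultimately have "regular_sequence (R Quot I) []" unfolding regular_sequence_def by auto
  from Q.krull_dim_ge_length_regular_sequence[OF this] show ?thesis by (simp add: zero_ereal_def)
qed

text \<open>
Chains of primes of a quotient are bounded by pulling them back; surjectivity keeps the inclusions
strict.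
\<close>

lemma krull_dim_le_via_surjective_hom:
  assumes h: "h \<in> Ring.ring_hom R B" and R: "cring R" and B: "ring B" and surj: "h ` carrier R = carrier B"
    and bound: "\<And>k P. (\<And>i. i \<le> k \<Longrightarrow> primeideal (P i) R) \<Longrightarrow> (\<And>i. i < k \<Longrightarrow> P i \<subset> P (Suc i)) \<Longrightarrow>
      {r \<in> carrier R. h r = \<zero>\<^bsub>B\<^esub>} \<subseteq> P 0 \<Longrightarrow> k \<le> d"
  shows "krull_dim B \<le> ereal (real d)"
  unfolding krull_dim_def
proof (rule Sup_least, clarsimp)
  fix k P assume P: "\<forall>i\<le>k. primeideal (P i) B" "\<forall>i<k. P i \<subset> P (Suc i)"
  interpret R: cring R by (rule R)
  interpret h: ring_hom_ring R B h
    by (rule ring_hom_ringI2[OF R.ring_axioms B h])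
  show "k \<le> d"
  proof (rule bound)
    fix i assume "i \<le> k"
    then show "primeideal {r \<in> carrier R. h r \<in> P i} R"
      using h.primeideal_vimage[OF R] P(1) by auto
  next
    fix i assume i: "i < k"
    then obtain b where b: "b \<in> P (Suc i)" "b \<notin> P i" using P(2) by blast
    interpret Pi: primeideal "P (Suc i)" B using P(1) i by auto
    have "b \<in> h ` carrier R" using b(1) Pi.Icarr surj by simp
    then obtain a where a: "a \<in> carrier R" "h a = b" by auto
    then show "{r \<in> carrier R. h r \<in> P i} \<subset> {r \<in> carrier R. h r \<in> P (Suc i)}"
      using P(2)[rule_format, OF i] a b by auto
  next
    interpret P0: primeideal "P 0" B using P(1) by auto
    show "{r \<in> carrier R. h r = \<zero>\<^bsub>B\<^esub>} \<subseteq> {r \<in> carrier R. h r \<in> P 0}" by auto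
  qed
qed

text \<open>
Translates membership in an ideal of a quotient ring, generated by residue classes, into membership in
an ideal of the ring itself. All later computations with the iterated quotients use it.
\<close>

lemma (in cring) rcos_mem_genideal_Quot_iff:
  assumes J: "ideal J R" and G: "G \<subseteq> carrier R" and p: "p \<in> carrier R"
  shows "J +> p \<in> genideal (R Quot J) ((+>) J ` G) \<longleftrightarrow> p \<in> Idl (J \<union> G)"
proof -
  interpret J: ideal J R by (rule J)
  interpret A: ring "R Quot J" by (rule J.quotient_is_ring)
  interpret q: ring_hom_ring R "R Quot J" "(+>) J" by (rule J.rcos_ring_hom_ring)
  have JG: "J \<union> G \<subseteq> carrier R" using J.Icarr G by auto
  have G': "(+>) J ` G \<subseteq> carrier (R Quot J)" using G by (auto simp: carrier_FactRing)
  show ?thesis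
  proof
    assume L: "J +> p \<in> genideal (R Quot J) ((+>) J ` G)"
    have "ideal ((+>) J ` (Idl (J \<union> G))) (R Quot J)"
      by (rule ring_ideal_imp_quot_ideal[OF J genideal_ideal[OF JG]])
    then have "genideal (R Quot J) ((+>) J ` G) \<subseteq> (+>) J ` (Idl (J \<union> G))"
      using genideal_self[OF JG] by (intro A.genideal_minimal) auto
    with L obtain r where r: "r \<in> Idl (J \<union> G)" "J +> p = J +> r" by auto
    interpret K: ideal "Idl (J \<union> G)" R by (rule genideal_ideal[OF JG])
    have "p \<ominus> r \<in> Idl (J \<union> G)"
      using J.rcos_eq_iff[of p r] r K.Icarr p genideal_self[OF JG] by auto
    then have "(p \<ominus> r) \<oplus> r \<in> Idl (J \<union> G)" using r K.a_closed by auto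
    moreover have "(p \<ominus> r) \<oplus> r = p" using p K.Icarr[OF r(1)] by algebra
    ultimately show "p \<in> Idl (J \<union> G)" by simp
  next
    assume R: "p \<in> Idl (J \<union> G)"
    interpret K: ideal "genideal (R Quot J) ((+>) J ` G)" "R Quot J" by (rule A.genideal_ideal[OF G'])
    have "J \<in> genideal (R Quot J) ((+>) J ` G)" using K.zero_closed by (simp add: zero_FactRing)
    then have "J \<union> G \<subseteq> {r \<in> carrier R. J +> r \<in> genideal (R Quot J) ((+>) J ` G)}"
      using A.genideal_self[OF G'] J.Icarr G J.rcos_eq_self_iff[OF J.Icarr]
      by (simp add: subset_iff Ball_def image_subset_iff)
    then have "Idl (J \<union> G) \<subseteq> {r \<in> carrier R. J +> r \<in> genideal (R Quot J) ((+>) J ` G)}"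
      by (intro genideal_minimal q.ideal_vimage K.is_ideal)
    then show "J +> p \<in> genideal (R Quot J) ((+>) J ` G)" using R by auto
  qed
qed

lemma (in cring) genideal_Un_genideal:
  assumes "C \<subseteq> carrier R" "G \<subseteq> carrier R"
  shows "Idl (Idl C \<union> G) = Idl (C \<union> G)"
proof
  have "C \<union> G \<subseteq> carrier R" using assms by auto
  note * = genideal_self[OF this] genideal_ideal[OF this]
  have "Idl C \<subseteq> Idl (C \<union> G)" using * by (intro genideal_minimal) auto
  then show "Idl (Idl C \<union> G) \<subseteq> Idl (C \<union> G)" using * by (intro genideal_minimal) auto
  interpret C: ideal "Idl C" R by (rule genideal_ideal[OF assms(1)])
  have "Idl C \<union> G \<subseteq> carrier R" using assms C.Icarr by auto
  note ** = genideal_self[OF this] genideal_ideal[OF this]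
  show "Idl (C \<union> G) \<subseteq> Idl (Idl C \<union> G)"
    using genideal_self[OF assms(1)] ** by (intro genideal_minimal) auto
qed

section \<open>Polynomials of bounded degree\<close>

definition smul :: "'k::field \<Rightarrow> ('v, 'k) mpoly \<Rightarrow> ('v, 'k) mpoly" where
  "smul a p = Poly_Mapping.single 0 a * p"

definition monomial :: "('v \<Rightarrow>\<^sub>0 nat) \<Rightarrow> ('v, 'k::field) mpoly" where
  "monomial m = Poly_Mapping.single m 1"

lemma smul_monomial: "smul a (monomial m) = Poly_Mapping.single m a"
  by (simp add: smul_def monomial_def mult_single)

lemma monomial_add: "monomial (m + m') = monomial m * monomial m'"
  by (simp add: monomial_def mult_single)

lemma monomial_zero: "monomial 0 = 1"
  by (simp add: monomial_def)

lemma indet_eq_monomial: "indet v = monomial (Poly_Mapping.single v 1)"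
  by (simp add: indet_def monomial_def)

lemma inj_monomial: "inj monomial"
  unfolding monomial_def by (auto intro!: injI dest: arg_cong[where f = Poly_Mapping.keys])

interpretation mp: vector_space "smul :: 'k::field \<Rightarrow> ('v, 'k) mpoly \<Rightarrow> ('v, 'k) mpoly"
proof
  fix a b :: 'k and x y :: "('v, 'k) mpoly"
  show "smul a (smul b x) = smul (a * b) x"
    by (simp add: smul_def mult.assoc[symmetric] mult_single)
qed (simp_all add: smul_def algebra_simps single_add)

lemma smul_mult_left: "smul a p * q = smul a (p * q)"
  and smul_mult_right: "p * smul a q = smul a (p * q)"
  by (simp_all add: smul_def mult_ac)

lemma lookup_smul: "Poly_Mapping.lookup (smul a p) m = a * Poly_Mapping.lookup p m"
  unfolding smul_def mult_map_scale_conv_mult[symmetric]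
  by (simp add: Poly_Mapping.map.rep_eq when_def)

lemma mpoly_eq_sum_monomials:
  assumes "finite S" "Poly_Mapping.keys p \<subseteq> S"
  shows "p = (\<Sum>m\<in>S. smul (Poly_Mapping.lookup p m) (monomial m))"
proof (rule poly_mapping_eqI)
  fix m
  have "Poly_Mapping.lookup p m = (if m \<in> S then Poly_Mapping.lookup p m else 0)"
    using assms(2) by (auto simp: in_keys_iff)
  also have "\<dots> = (\<Sum>m'\<in>S. if m' = m then Poly_Mapping.lookup p m' else 0)"
    using assms(1) by simp
  also have "\<dots> = Poly_Mapping.lookup (\<Sum>m\<in>S. smul (Poly_Mapping.lookup p m) (monomial m)) m"
    by (simp add: lookup_sum smul_monomial lookup_single when_def)
  finally show "Poly_Mapping.lookup p m = \<dots>" .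
qed

lemma mpoly_induct [case_names monomial zero add]:
  assumes "\<And>m a. m \<in> Poly_Mapping.keys p \<Longrightarrow> P (smul a (monomial m))"
    and "P 0" and "\<And>p q. P p \<Longrightarrow> P q \<Longrightarrow> P (p + q)"
  shows "P p"
proof -
  have "P (\<Sum>m\<in>S. smul (Poly_Mapping.lookup p m) (monomial m))" if "finite S" "S \<subseteq> Poly_Mapping.keys p" for S
    using that by (induction S rule: finite_induct) (use assms in auto)
  from this[of "Poly_Mapping.keys p"] show ?thesis
    using mpoly_eq_sum_monomials[of "Poly_Mapping.keys p" p] by simp
qed

lemma lookup_monomial_mult: "Poly_Mapping.lookup (monomial m * p) (m + m') = Poly_Mapping.lookup p m'"
  by (induction p arbitrary: m' rule: mpoly_induct)
     (auto simp: smul_monomial monomial_def[of m] mult_single lookup_single when_def distrib_left lookup_add)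

lemma independent_monomials: "mp.independent (monomial ` S)"
  unfolding mp.independent_explicit_finite_subsets
proof (intro allI impI ballI)
  fix B u p assume B: "B \<subseteq> monomial ` S" "finite B" "(\<Sum>p\<in>B. smul (u p) p) = 0" and p: "p \<in> B"
  obtain T where T: "finite T" "B = monomial ` T"
    using finite_subset_image[OF B(2,1)] by blast
  obtain m where m: "m \<in> T" "p = monomial m" using p T by blast
  have "0 = Poly_Mapping.lookup (\<Sum>m'\<in>T. smul (u (monomial m')) (monomial m')) m"
    using B(3) unfolding T(2) by (subst (asm) sum.reindex) (auto intro: inj_on_subset[OF inj_monomial])
  also have "\<dots> = (\<Sum>m'\<in>T. if m' = m then u (monomial m') else 0)"
    by (simp add: lookup_sum smul_monomial lookup_single when_def)
  also have "\<dots> = u p" using T(1) m by simp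
  finally show "u p = 0" by simp
qed

lemma total_degree_eq_sum:
  assumes "finite A" "Poly_Mapping.keys m \<subseteq> A"
  shows "total_degree m = (\<Sum>v\<in>A. Poly_Mapping.lookup m v)"
  unfolding total_degree_def
  by (rule sum.mono_neutral_left) (use assms in \<open>auto simp: in_keys_iff\<close>)

lemma total_degree_add: "total_degree (m + m') = total_degree m + total_degree m'"
proof -
  let ?A = "Poly_Mapping.keys m \<union> Poly_Mapping.keys m'"
  have "Poly_Mapping.keys (m + m') \<subseteq> ?A" by (rule Poly_Mapping.keys_add)
  then show ?thesis
    by (simp add: total_degree_eq_sum[of ?A] lookup_add sum.distrib)
qed

lemma total_degree_single: "total_degree (Poly_Mapping.single v k) = k"
  by (cases "k = 0") (simp_all add: total_degree_def)

lemma total_degree_zero: "total_degree 0 = 0"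
  by (simp add: total_degree_def)

lemma lookup_le_total_degree: "Poly_Mapping.lookup m v \<le> total_degree m"
proof (cases "v \<in> Poly_Mapping.keys m")
  case True
  then show ?thesis unfolding total_degree_def by (intro member_le_sum) auto
qed (simp add: in_keys_iff)

lemma
  assumes "finite V"
  shows finite_box: "finite {m. Poly_Mapping.keys m \<subseteq> V \<and> (\<forall>v\<in>V. Poly_Mapping.lookup m v \<le> u v)}" (is "finite ?B")
    and card_box: "card {m. Poly_Mapping.keys m \<subseteq> V \<and> (\<forall>v\<in>V. Poly_Mapping.lookup m v \<le> u v)}
      \<le> (\<Prod>v\<in>V. Suc (u v))"
proof -
  let ?f = "\<lambda>m. restrict (Poly_Mapping.lookup m) V"
  have inj: "inj_on ?f ?B"
  proof (rule inj_onI, rule poly_mapping_eqI)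
    fix m m' v assume m: "m \<in> ?B" "m' \<in> ?B" "?f m = ?f m'"
    show "Poly_Mapping.lookup m v = Poly_Mapping.lookup m' v"
    proof (cases "v \<in> V")
      case True
      then show ?thesis using fun_cong[OF m(3), of v] by simp
    next
      case False
      then have "v \<notin> Poly_Mapping.keys m" "v \<notin> Poly_Mapping.keys m'" using m by auto
      then show ?thesis by (simp add: in_keys_iff)
    qed
  qed
  have sub: "?f ` ?B \<subseteq> PiE V (\<lambda>v. {..u v})" by auto
  have fin: "finite (PiE V (\<lambda>v. {..u v}))" using assms by (intro finite_PiE) auto
  show "finite ?B" using inj_on_finite[OF inj sub fin] .
  show "card ?B \<le> (\<Prod>v\<in>V. Suc (u v))"
    using card_inj_on_le[OF inj sub fin] by (simp add: card_PiE[OF assms])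
qed

text \<open>
Bounded total degree cuts the polynomial ring into finite-dimensional pieces, so that spanning sets can
be compared by counting.
\<close>

definition monomials_le :: "'v set \<Rightarrow> nat \<Rightarrow> ('v \<Rightarrow>\<^sub>0 nat) set" where
  "monomials_le V d = {m. Poly_Mapping.keys m \<subseteq> V \<and> total_degree m \<le> d}"

definition polys_le :: "'v set \<Rightarrow> nat \<Rightarrow> ('v, 'k::field) mpoly set" where
  "polys_le V d = {p. Poly_Mapping.keys p \<subseteq> monomials_le V d}"

lemma finite_monomials_le:
  assumes "finite V"
  shows "finite (monomials_le V d)"
  by (rule finite_subset[OF _ finite_box[OF assms, of "\<lambda>_. d"]])
     (auto simp: monomials_le_def intro: lookup_le_total_degree le_trans)

lemma monomials_le_add:
  "m \<in> monomials_le V i \<Longrightarrow> m' \<in> monomials_le V j \<Longrightarrow> m + m' \<in> monomials_le V (i + j)"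
  using Poly_Mapping.keys_add[of m m'] by (fastforce simp: monomials_le_def total_degree_add)

lemma subspace_polys_le: 
  fixes V :: "'v set"
  shows "mp.subspace (polys_le V d)"
proof (rule mp.subspaceI)
  show "0 \<in> polys_le V d" by (simp add: polys_le_def)
  show "x + y \<in> polys_le V d" if "x \<in> polys_le V d" "y \<in> polys_le V d" for x y
    using that Poly_Mapping.keys_add[of x y] by (auto simp: polys_le_def)
  show "smul a x \<in> polys_le V d" if "x \<in> polys_le V d" for a x
    using that by (auto simp: polys_le_def in_keys_iff lookup_smul)
qed

lemma monomial_in_polys_le_iff: "monomial m \<in> polys_le V d \<longleftrightarrow> m \<in> monomials_le V d"
  by (simp add: polys_le_def monomial_def)

lemma polys_le_eq_span:
  fixes V :: "'v set"
  shows "(polys_le V d :: ('v, 'k::field) mpoly set) = mp.span (monomial ` monomials_le V d)"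
    (is "?L = ?R")
proof
  show "?L \<subseteq> ?R"
  proof
    fix p :: "('v, 'k) mpoly" assume "p \<in> polys_le V d"
    then have "m \<in> monomials_le V d" if "m \<in> Poly_Mapping.keys p" for m
      using that by (auto simp: polys_le_def)
    then show "p \<in> mp.span (monomial ` monomials_le V d)"
      by (intro mpoly_induct[of p "\<lambda>p. p \<in> mp.span (monomial ` monomials_le V d)"])
         (auto intro: mp.span_add mp.span_scale mp.span_base mp.span_zero)
  qed
  show "?R \<subseteq> ?L"
    by (rule mp.span_minimal) (auto simp: monomial_in_polys_le_iff subspace_polys_le)
qed

lemma polys_le_mult: "p \<in> polys_le V i \<Longrightarrow> q \<in> polys_le V j \<Longrightarrow> p * q \<in> polys_le V (i + j)"
  using Poly_Mapping.keys_mult[of p q] by (force simp: polys_le_def intro: monomials_le_add)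

lemma one_in_polys_le: "1 \<in> polys_le V d"
  by (simp add: polys_le_def monomials_le_def total_degree_zero)

lemma polys_le_mono: "i \<le> j \<Longrightarrow> polys_le V i \<subseteq> polys_le V j"
  by (auto simp: polys_le_def monomials_le_def intro: le_trans)

lemma polys_le_power: "p \<in> polys_le V d \<Longrightarrow> p ^ k \<in> polys_le V (k * d)"
  by (induction k) (auto simp: one_in_polys_le intro: polys_le_mult)

lemma polys_le_prod:
  assumes "finite A" "\<And>i. i \<in> A \<Longrightarrow> f i \<in> polys_le V (e i)"
  shows "(\<Prod>i\<in>A. f i) \<in> polys_le V (\<Sum>i\<in>A. e i)"
  using assms by (induction A rule: finite_induct) (auto simp: one_in_polys_le intro: polys_le_mult)

lemma indet_in_polys_le_iff: "indet v \<in> polys_le V 1 \<longleftrightarrow> v \<in> V"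
  by (simp add: indet_eq_monomial monomial_in_polys_le_iff monomials_le_def total_degree_single)

lemma polys_le_subset_carrier: "polys_le V d \<subseteq> carrier (poly_ring V)"
  by (auto simp: polys_le_def monomials_le_def poly_ring_def)

lemma carrier_poly_ring_imp_polys_le:
  assumes "p \<in> carrier (poly_ring V)"
  shows "\<exists>d. p \<in> polys_le V d"
proof -
  have "\<And>m. m \<in> Poly_Mapping.keys p \<Longrightarrow> total_degree m \<le> (\<Sum>m\<in>Poly_Mapping.keys p. total_degree m)"
    by (rule member_le_sum) auto
  then show ?thesis
    using assms unfolding poly_ring_def polys_le_def monomials_le_def
    by (intro exI[of _ "\<Sum>m\<in>Poly_Mapping.keys p. total_degree m"]) auto
qed

lemma carrier_poly_ring_eq:
  fixes V :: "'v set"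
  shows "carrier (poly_ring V :: ('v, 'k::field) mpoly ring) = (\<Union>d. polys_le V d)"
proof (intro equalityI subsetI)
  fix p :: "('v, 'k) mpoly"
  show "p \<in> (\<Union>d. polys_le V d)" if "p \<in> carrier (poly_ring V)"
    using carrier_poly_ring_imp_polys_le[OF that] by simp
  show "p \<in> carrier (poly_ring V)" if "p \<in> (\<Union>d. polys_le V d)"
    using that subsetD[OF polys_le_subset_carrier] by (elim UN_E)
qed

lemma poly_ring_simps:
  "monoid.mult (poly_ring V) = (*)" "\<one>\<^bsub>poly_ring V\<^esub> = 1" "\<zero>\<^bsub>poly_ring V\<^esub> = 0" "add (poly_ring V) = (+)"
  by (simp_all add: poly_ring_def)

lemma subspace_poly_ring:
  fixes V :: "'v set"
  shows "mp.subspace (carrier (poly_ring V :: ('v, 'k::field) mpoly ring))"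
proof (rule mp.subspaceI)
  show "0 \<in> carrier (poly_ring V)" by (simp add: poly_ring_def)
  show "x + y \<in> carrier (poly_ring V)" if "x \<in> carrier (poly_ring V)" "y \<in> carrier (poly_ring V)"
    for x y :: "('v, 'k) mpoly"
    using that Poly_Mapping.keys_add[of x y] unfolding poly_ring_def by auto
  show "smul a x \<in> carrier (poly_ring V)" if "x \<in> carrier (poly_ring V)"
    for a and x :: "('v, 'k) mpoly"
    using that by (simp add: poly_ring_def in_keys_iff lookup_smul)
qed

lemma poly_ring_mult_closed:
  assumes "p \<in> carrier (poly_ring V)" "q \<in> carrier (poly_ring V)"
  shows "p * q \<in> carrier (poly_ring V)"
proof -
  obtain i j where "p \<in> polys_le V i" "q \<in> polys_le V j"
    using assms[THEN carrier_poly_ring_imp_polys_le] by (elim exE)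
  then have "p * q \<in> polys_le V (i + j)" by (rule polys_le_mult)
  then show ?thesis by (rule subsetD[OF polys_le_subset_carrier])
qed

lemma cring_poly_ring:
  fixes V :: "'v set"
  shows "cring (poly_ring V :: ('v, 'k::field) mpoly ring)"
proof (rule cringI)
  let ?R = "poly_ring V :: ('v, 'k) mpoly ring"
  have "\<exists>y\<in>carrier ?R. y + x = 0" if "x \<in> carrier ?R" for x
    using that mp.subspace_neg[OF subspace_poly_ring] by (intro bexI[of _ "- x"]) auto
  then show "abelian_group ?R"
    using mp.subspace_0[OF subspace_poly_ring, of V] mp.subspace_add[OF subspace_poly_ring]
    by (intro abelian_groupI) (auto simp: poly_ring_simps add_ac)
  have "1 \<in> carrier ?R" by (simp add: poly_ring_def)
  then show "comm_monoid ?R"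
    by (intro comm_monoidI) (simp_all add: poly_ring_simps mult_ac poly_ring_mult_closed)
qed (simp add: poly_ring_simps algebra_simps)

section \<open>A basis adapted to a monic quadratic system\<close>

lemma prod_scale_one_factor:
  fixes f g :: "'a \<Rightarrow> 'adapted::comm_monoid_mult"
  assumes "finite A" "a \<in> A" "f a = x * g a" "\<And>u. u \<in> A \<Longrightarrow> u \<noteq> a \<Longrightarrow> f u = g u"
  shows "prod f A = x * prod g A"
proof -
  have "prod f A = f a * prod f (A - {a})" "prod g A = g a * prod g (A - {a})"
    using assms(1,2) by (simp_all add: prod.remove)
  moreover have "prod f (A - {a}) = prod g (A - {a})"
    by (rule prod.cong) (use assms in auto)
  ultimately show ?thesis using assms(3) by (simp add: mult.assoc)
qed

text \<open>
The abstract situation: coordinates split into \<open>Z\<close> and the rest, each remaining coordinate \<open>v\<close> is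
modified by a linear form in \<open>Z\<close> to a parameter \<open>\<pi> v\<close>, and every \<open>z \<in> Z\<close> comes with a quadric \<open>c z\<close>
that is congruent to \<open>z\<^sup>2\<close> modulo the parameters.
\<close>

locale monic_quadratic_system =
  fixes V Z :: "'v set" and \<pi> c :: "'v \<Rightarrow> ('v, 'k::field) mpoly"
  assumes finite_V: "finite V" and Z_subset: "Z \<subseteq> V"
    and param_deg: "\<And>v. v \<in> V - Z \<Longrightarrow> \<pi> v \<in> polys_le V 1"
    and indet_minus_param: "\<And>v. v \<in> V - Z \<Longrightarrow> indet v - \<pi> v \<in> mp.span (indet ` Z)"
    and monic: "\<And>z. z \<in> Z \<Longrightarrow>
      c z - indet z ^ 2 \<in> mp.span {\<pi> v * q | v q. v \<in> V - Z \<and> q \<in> polys_le V 1}"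
begin

text \<open>
The image of the monomial \<open>m\<close> when variables outside \<open>Z\<close> are replaced by their parameters and each
\<open>z\<^sup>2\<close> is traded for \<open>c z\<close>, as often as possible.
\<close>

definition adapted :: "('v \<Rightarrow>\<^sub>0 nat) \<Rightarrow> ('v, 'k) mpoly" where
  "adapted m = (\<Prod>v\<in>V - Z. \<pi> v ^ Poly_Mapping.lookup m v) *
     (\<Prod>z\<in>Z. c z ^ (Poly_Mapping.lookup m z div 2) * indet z ^ (Poly_Mapping.lookup m z mod 2))"

lemma finite_sets: "finite Z" "finite (V - Z)"
  using finite_V Z_subset finite_subset by auto

lemma adapted_zero: "adapted 0 = 1"
  by (simp add: adapted_def)

lemma adapted_add_param:
  assumes "v \<in> V - Z"
  shows "adapted (Poly_Mapping.single v 1 + m) = \<pi> v * adapted m"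
proof -
  have "(\<Prod>u\<in>V - Z. \<pi> u ^ Poly_Mapping.lookup (Poly_Mapping.single v 1 + m) u)
    = \<pi> v * (\<Prod>u\<in>V - Z. \<pi> u ^ Poly_Mapping.lookup m u)"
    by (rule prod_scale_one_factor[OF finite_sets(2) assms])
       (auto simp: lookup_add lookup_single when_def)
  moreover have "(\<Prod>z\<in>Z. c z ^ (Poly_Mapping.lookup (Poly_Mapping.single v 1 + m) z div 2)
        * indet z ^ (Poly_Mapping.lookup (Poly_Mapping.single v 1 + m) z mod 2))
    = (\<Prod>z\<in>Z. c z ^ (Poly_Mapping.lookup m z div 2) * indet z ^ (Poly_Mapping.lookup m z mod 2))"
    by (rule prod.cong) (use assms in \<open>auto simp: lookup_add lookup_single when_def\<close>)
  ultimately show ?thesis by (simp add: adapted_def mult.assoc)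
qed

lemma adapted_scale_at:
  assumes "z \<in> Z" "\<And>u. u \<noteq> z \<Longrightarrow> Poly_Mapping.lookup m' u = Poly_Mapping.lookup m u"
    and "c z ^ (Poly_Mapping.lookup m' z div 2) * indet z ^ (Poly_Mapping.lookup m' z mod 2)
      = x * (c z ^ (Poly_Mapping.lookup m z div 2) * indet z ^ (Poly_Mapping.lookup m z mod 2))"
  shows "adapted m' = x * adapted m"
proof -
  have "(\<Prod>v\<in>V - Z. \<pi> v ^ Poly_Mapping.lookup m' v) = (\<Prod>v\<in>V - Z. \<pi> v ^ Poly_Mapping.lookup m v)"
    by (rule prod.cong[OF refl], subst assms(2)) (use assms(1) in auto)
  moreover have "(\<Prod>z\<in>Z. c z ^ (Poly_Mapping.lookup m' z div 2) * indet z ^ (Poly_Mapping.lookup m' z mod 2))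
    = x * (\<Prod>z\<in>Z. c z ^ (Poly_Mapping.lookup m z div 2) * indet z ^ (Poly_Mapping.lookup m z mod 2))"
    by (rule prod_scale_one_factor[OF finite_sets(1) assms(1)]) (rule assms(3), simp add: assms(2))
  ultimately show ?thesis by (simp add: adapted_def mult_ac)
qed

lemma adapted_add_square:
  assumes "z \<in> Z"
  shows "adapted (Poly_Mapping.single z 2 + m) = c z * adapted m"
  by (rule adapted_scale_at[OF assms]) (auto simp: lookup_add lookup_single when_def mult_ac)

lemma adapted_add_var:
  assumes "z \<in> Z" "even (Poly_Mapping.lookup m z)"
  shows "adapted (Poly_Mapping.single z 1 + m) = indet z * adapted m"
proof (rule adapted_scale_at[OF assms(1)])
  let ?k = "Poly_Mapping.lookup m z"
  have "Suc ?k div 2 = ?k div 2" "Suc ?k mod 2 = 1" "?k mod 2 = 0"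
    using assms(2) by presburger+
  then show "c z ^ (Poly_Mapping.lookup (Poly_Mapping.single z 1 + m) z div 2)
      * indet z ^ (Poly_Mapping.lookup (Poly_Mapping.single z 1 + m) z mod 2)
    = indet z * (c z ^ (?k div 2) * indet z ^ (?k mod 2))"
    by (simp add: lookup_add mult_ac)
qed (simp add: lookup_add lookup_single when_def)

lemma c_deg:
  assumes "z \<in> Z"
  shows "c z \<in> polys_le V 2"
proof -
  have "mp.span {\<pi> v * q | v q. v \<in> V - Z \<and> q \<in> polys_le V 1} \<subseteq> polys_le V (1 + 1)"
    using polys_le_mult[OF param_deg]
    by (intro mp.span_minimal[OF _ subspace_polys_le] subsetI) (elim CollectE exE conjE, simp only:)
  moreover have "indet z * indet z \<in> polys_le V (1 + 1)"
    by (rule polys_le_mult; unfold indet_in_polys_le_iff; use assms Z_subset in blast)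
  ultimately have "(c z - indet z ^ 2) + indet z ^ 2 \<in> polys_le V (1 + 1)"
    using subsetD[OF _ monic[OF assms]] unfolding power2_eq_square
    by (intro mp.subspace_add[OF subspace_polys_le]) simp_all
  then show ?thesis by (simp add: numeral_2_eq_2)
qed

lemma adapted_deg:
  assumes "Poly_Mapping.keys m \<subseteq> V"
  shows "adapted m \<in> polys_le V (total_degree m)"
proof -
  let ?e = "Poly_Mapping.lookup m"
  have "(\<Prod>v\<in>V - Z. \<pi> v ^ ?e v) \<in> polys_le V (\<Sum>v\<in>V - Z. ?e v)"
    using polys_le_power[OF param_deg] by (intro polys_le_prod finite_sets) auto
  moreover have "c z ^ (?e z div 2) * indet z ^ (?e z mod 2) \<in> polys_le V (?e z)" if "z \<in> Z" for z
  proof -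
    have "c z ^ (?e z div 2) * indet z ^ (?e z mod 2) \<in> polys_le V ((?e z div 2) * 2 + (?e z mod 2) * 1)"
      using that Z_subset
      by (intro polys_le_mult polys_le_power c_deg) (auto simp: indet_in_polys_le_iff simp del: One_nat_def)
    then show ?thesis by simp
  qed
  then have "(\<Prod>z\<in>Z. c z ^ (?e z div 2) * indet z ^ (?e z mod 2)) \<in> polys_le V (\<Sum>z\<in>Z. ?e z)"
    by (intro polys_le_prod finite_sets) auto
  ultimately have "adapted m \<in> polys_le V ((\<Sum>v\<in>V - Z. ?e v) + (\<Sum>z\<in>Z. ?e z))"
    unfolding adapted_def by (rule polys_le_mult)
  moreover have "total_degree m = (\<Sum>v\<in>V - Z. ?e v) + (\<Sum>z\<in>Z. ?e z)"
    using total_degree_eq_sum[OF finite_V assms] sum.subset_diff[OF Z_subset finite_V, of ?e] by simp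
  ultimately show ?thesis by simp
qed

lemma adapted_deg_le: "m \<in> monomials_le V d \<Longrightarrow> adapted m \<in> polys_le V d"
  using adapted_deg polys_le_mono unfolding monomials_le_def by blast

lemma single_add_in_monomials_le:
  assumes "v \<in> V" "m \<in> monomials_le V d"
  shows "Poly_Mapping.single v k + m \<in> monomials_le V (k + d)"
proof (rule monomials_le_add[OF _ assms(2)])
  show "Poly_Mapping.single v k \<in> monomials_le V k"
    using assms(1) by (auto simp: monomials_le_def total_degree_single)
qed

lemma param_mult_span:
  assumes "v \<in> V - Z" "w \<in> mp.span (adapted ` monomials_le V d)"
  shows "\<pi> v * w \<in> mp.span (adapted ` monomials_le V (Suc d))"
  using assms(2)
proof (induction rule: mp.span_induct_alt)
  case base
  show ?case by (simp add: mp.span_zero)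
next
  case (step a x y)
  then obtain m where m: "m \<in> monomials_le V d" "x = adapted m" by auto
  have "\<pi> v * x \<in> adapted ` monomials_le V (Suc d)"
    using adapted_add_param[OF assms(1), of m] single_add_in_monomials_le[of v m d 1] assms(1) m by (auto intro!: image_eqI)
  then show ?case using step
    by (simp add: distrib_left smul_mult_right mp.span_add mp.span_scale mp.span_base)
qed

text \<open>
Multiplying an adapted product by \<open>z\<close> again gives an adapted product if its exponent of \<open>z\<close> is
even. If it is odd, \<open>z \<sqdot> z\<close> is replaced by \<open>c z\<close> minus terms \<open>\<pi> v * q\<close> with \<open>q\<close> linear. The cofactor of
\<open>\<pi> v\<close> then has degree at most \<open>d\<close>, where the span is already everything, and multiplication by \<open>\<pi> v\<close>
preserves adapted products.
\<close>

lemma var_mult_span: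
  assumes IH: "polys_le V d \<subseteq> mp.span (adapted ` monomials_le V d)"
    and z: "z \<in> Z" and w: "w \<in> mp.span (adapted ` monomials_le V d)"
  shows "indet z * w \<in> mp.span (adapted ` monomials_le V (Suc d))"
proof -
  have zV: "z \<in> V" using z Z_subset by auto
  have gen: "indet z * adapted m \<in> mp.span (adapted ` monomials_le V (Suc d))" if m: "m \<in> monomials_le V d" for m
  proof (cases "even (Poly_Mapping.lookup m z)")
    case True
    have "indet z * adapted m \<in> adapted ` monomials_le V (Suc d)"
      using adapted_add_var[OF z True] single_add_in_monomials_le[OF zV m, of 1] by (auto intro!: image_eqI)
    then show ?thesis by (rule mp.span_base)
  next
    case False
    define m' where "m' = m - Poly_Mapping.single z 1"
    have e: "m = Poly_Mapping.single z 1 + m'"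
      using False by (intro poly_mapping_eqI)
        (auto simp: m'_def lookup_add lookup_minus lookup_single when_def odd_pos Suc_le_eq)
    have m': "m' \<in> monomials_le V (d - 1)" "d \<ge> 1" "even (Poly_Mapping.lookup m' z)"
    proof -
      have "Poly_Mapping.keys m' \<subseteq> Poly_Mapping.keys m"
        by (auto simp: m'_def in_keys_iff lookup_minus)
      moreover have "total_degree m = Suc (total_degree m')"
        using arg_cong[OF e, of total_degree] by (simp add: total_degree_add total_degree_single)
      ultimately show "m' \<in> monomials_le V (d - 1)" "d \<ge> 1"
        using m by (auto simp: monomials_le_def)
      show "even (Poly_Mapping.lookup m' z)"
        using False arg_cong[OF e, of "\<lambda>m. Poly_Mapping.lookup m z"] by (simp add: lookup_add lookup_single)
    qed
    have "indet z * adapted m = c z * adapted m' - (c z - indet z ^ 2) * adapted m'"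
      unfolding e adapted_add_var[OF z m'(3)] by (simp add: algebra_simps power2_eq_square)
    moreover have "c z * adapted m' \<in> mp.span (adapted ` monomials_le V (Suc d))"
    proof -
      have "Poly_Mapping.single z 2 + m' \<in> monomials_le V (Suc d)"
        using single_add_in_monomials_le[OF zV m'(1), of 2] m'(2) by simp
      then show ?thesis using adapted_add_square[OF z, of m'] by (metis imageI mp.span_base)
    qed
    moreover have "x * adapted m' \<in> mp.span (adapted ` monomials_le V (Suc d))"
      if "x \<in> mp.span {\<pi> v * q | v q. v \<in> V - Z \<and> q \<in> polys_le V 1}" for x
      using that
    proof (induction rule: mp.span_induct_alt)
      case base
      show ?case by (simp add: mp.span_zero)
    next
      case (step a x y)
      then obtain v q where vq: "v \<in> V - Z" "q \<in> polys_le V 1" "x = \<pi> v * q" by auto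
      have "q * adapted m' \<in> polys_le V (1 + (d - 1))"
        by (rule polys_le_mult[OF vq(2) adapted_deg_le[OF m'(1)]])
      then have "\<pi> v * (q * adapted m') \<in> mp.span (adapted ` monomials_le V (Suc d))"
        using IH m'(2) by (intro param_mult_span vq) auto
      then show ?case using step vq
        by (simp add: distrib_right smul_mult_left mp.span_add mp.span_scale mult.assoc)
    qed
    ultimately show ?thesis using monic[OF z] by (simp add: mp.span_diff)
  qed
  show ?thesis using w
    by (induction rule: mp.span_induct_alt)
       (auto simp: mp.span_zero distrib_left smul_mult_right mp.span_add mp.span_scale gen)
qed

text \<open>
Induction on the degree: a monomial of degree \<open>d + 1\<close> is a variable times a polynomial of degree \<open>d\<close>,
and a variable outside \<open>Z\<close> is its parameter plus a linear form in \<open>Z\<close>.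
\<close>

lemma polys_le_subset_span_adapted: "polys_le V d \<subseteq> mp.span (adapted ` monomials_le V d)"
proof (induction d)
  case 0
  have "monomials_le V 0 = {0}"
    by (auto simp: monomials_le_def total_degree_def in_keys_iff intro!: poly_mapping_eqI)
  then show ?case by (simp add: polys_le_eq_span adapted_zero monomial_zero)
next
  case (Suc d)
  have "indet v * w \<in> mp.span (adapted ` monomials_le V (Suc d))"
    if v: "v \<in> V" and w: "w \<in> polys_le V d" for v w
  proof (cases "v \<in> Z")
    case True
    then show ?thesis using var_mult_span[OF Suc] Suc w by auto
  next
    case False
    have "x * w \<in> mp.span (adapted ` monomials_le V (Suc d))" if "x \<in> mp.span (indet ` Z)" for x
      using that
      by (induction rule: mp.span_induct_alt)
         (use var_mult_span[OF Suc] Suc w in \<open>auto simp: mp.span_zero distrib_right smul_mult_left mp.span_add mp.span_scale\<close>)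
    then have "(indet v - \<pi> v) * w + \<pi> v * w \<in> mp.span (adapted ` monomials_le V (Suc d))"
      using indet_minus_param param_mult_span v w Suc False by (intro mp.span_add) auto
    then show ?thesis by (simp add: algebra_simps)
  qed note step = this
  have "monomial m \<in> mp.span (adapted ` monomials_le V (Suc d))" if m: "m \<in> monomials_le V (Suc d)" for m
  proof (cases "m = 0")
    case True
    then show ?thesis
      using adapted_zero by (auto simp: monomial_zero monomials_le_def total_degree_zero intro!: mp.span_base image_eqI[of _ _ 0])
  next
    case False
    then obtain v where v: "v \<in> Poly_Mapping.keys m" by fastforce
    define m' where "m' = m - Poly_Mapping.single v 1"
    have e: "m = Poly_Mapping.single v 1 + m'"
      using v by (intro poly_mapping_eqI)
        (auto simp: m'_def lookup_add lookup_minus lookup_single when_def in_keys_iff)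
    have "Poly_Mapping.keys m' \<subseteq> Poly_Mapping.keys m"
      by (auto simp: m'_def in_keys_iff lookup_minus)
    moreover have "total_degree m = Suc (total_degree m')"
      using arg_cong[OF e, of total_degree] by (simp add: total_degree_add total_degree_single)
    ultimately have "m' \<in> monomials_le V d" using m by (auto simp: monomials_le_def)
    then have "indet v * monomial m' \<in> mp.span (adapted ` monomials_le V (Suc d))"
      using v m by (intro step) (auto simp: monomials_le_def monomial_in_polys_le_iff)
    then show ?thesis by (metis e indet_eq_monomial monomial_add)
  qed
  then show ?case unfolding polys_le_eq_span by (intro mp.span_minimal) auto
qed

text \<open>
In degree at most \<open>d\<close> the adapted products are indexed by the monomials and span them. As the monomials
are independent, no two adapted products can coincide and none can be redundant.
\<close>

lemma independent_adapted: "mp.independent (adapted ` monomials_le V d)"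
  and inj_on_adapted: "inj_on adapted (monomials_le V d)"
proof -
  let ?M = "monomials_le V d" and ?mon = "monomial :: _ \<Rightarrow> ('v, 'k) mpoly"
  have fin: "finite ?M" by (rule finite_monomials_le[OF finite_V])
  have card: "card (?mon ` ?M) = card ?M"
    by (rule card_image[OF inj_on_subset[OF inj_monomial]]) simp
  have span: "?mon ` ?M \<subseteq> mp.span (adapted ` ?M)"
    using polys_le_subset_span_adapted[of d] by (auto simp: monomial_in_polys_le_iff)
  have le: "card ?M \<le> card S" if "finite S" "?mon ` ?M \<subseteq> mp.span S" for S
    using mp.independent_span_bound[OF that(1) independent_monomials that(2)] card by simp
  show "inj_on adapted ?M"
    using le[OF _ span] fin card_image_le[OF fin, of adapted] by (intro eq_card_imp_inj_on) auto
  show "mp.independent (adapted ` ?M)"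
  proof
    assume "mp.dependent (adapted ` ?M)"
    then obtain x where x: "x \<in> adapted ` ?M" "x \<in> mp.span (adapted ` ?M - {x})"
      unfolding mp.dependent_def by auto
    then have "mp.span (adapted ` ?M - {x}) = mp.span (adapted ` ?M)"
      using mp.span_redundant[OF x(2)] by (simp add: insert_absorb)
    then have "card ?M \<le> card (adapted ` ?M - {x})" using le span fin by auto
    also have "\<dots> < card (adapted ` ?M)" using x(1) fin by (intro card_Diff1_less) auto
    also have "\<dots> \<le> card ?M" by (rule card_image_le[OF fin])
    finally show False by simp
  qed
qed

definition expand :: "('v, 'k) mpoly \<Rightarrow> ('v, 'k) mpoly" where
  "expand p = (\<Sum>m\<in>Poly_Mapping.keys p. smul (Poly_Mapping.lookup p m) (adapted m))"

lemma expand_eq_sum: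
  assumes "finite S" "Poly_Mapping.keys p \<subseteq> S"
  shows "expand p = (\<Sum>m\<in>S. smul (Poly_Mapping.lookup p m) (adapted m))"
  unfolding expand_def
  by (rule sum.mono_neutral_left) (use assms in \<open>auto simp: in_keys_iff\<close>)

lemma linear_expand: "Vector_Spaces.linear smul smul expand"
proof (rule linear_module_homI, unfold_locales)
  fix p q :: "('v, 'k) mpoly" and a
  let ?S = "Poly_Mapping.keys p \<union> Poly_Mapping.keys q"
  show "expand (p + q) = expand p + expand q"
    using Poly_Mapping.keys_add[of p q]
    by (simp add: expand_eq_sum[of ?S] lookup_add mp.scale_left_distrib sum.distrib)
  show "expand (smul a p) = smul a (expand p)"
    by (subst expand_eq_sum[of "Poly_Mapping.keys p"])
       (auto simp: expand_def lookup_smul mp.scale_sum_right in_keys_iff)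
qed

interpretation expand: Vector_Spaces.linear smul smul expand
  by (rule linear_expand)

lemma expand_monomial: "expand (monomial m) = adapted m"
  by (simp add: expand_def monomial_def)

lemma expand_image_polys_le: "expand ` polys_le V d = mp.span (adapted ` monomials_le V d)"
  by (simp add: polys_le_eq_span expand.span_image[symmetric] image_image expand_monomial)

lemma polys_le_eq_span_adapted: "polys_le V d = mp.span (adapted ` monomials_le V d)"
  using polys_le_subset_span_adapted mp.span_minimal[OF _ subspace_polys_le] adapted_deg_le
  by (metis image_subsetI subset_antisym)

lemma expand_image_polys_le_eq: "expand ` polys_le V d = polys_le V d"
  unfolding expand_image_polys_le by (rule polys_le_eq_span_adapted[symmetric])

lemma inj_on_expand_polys_le: "inj_on expand (polys_le V d)"
proof -
  have "inj_on expand (monomial ` monomials_le V d)"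
    using inj_on_adapted by (auto simp: inj_on_def expand_monomial)
  moreover have "mp.independent (expand ` monomial ` monomials_le V d)"
    using independent_adapted by (simp add: image_image expand_monomial)
  ultimately show ?thesis unfolding polys_le_eq_span
    by (simp add: expand.inj_on_span_iff_independent_image)
qed

lemma bij_betw_expand: "bij_betw expand (carrier (poly_ring V)) (carrier (poly_ring V))"
proof (rule bij_betw_imageI)
  show "expand ` carrier (poly_ring V) = carrier (poly_ring V)"
    unfolding carrier_poly_ring_eq by (simp add: image_UN expand_image_polys_le_eq)
  show "inj_on expand (carrier (poly_ring V))"
  proof (rule inj_onI)
    fix p q assume pq: "p \<in> carrier (poly_ring V)" "q \<in> carrier (poly_ring V)" "expand p = expand q"
    obtain i j where "p \<in> polys_le V i" "q \<in> polys_le V j"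
      using pq(1,2)[THEN carrier_poly_ring_imp_polys_le] by (elim exE)
    then have "p \<in> polys_le V (max i j)" "q \<in> polys_le V (max i j)"
      using polys_le_mono[of i "max i j" V] polys_le_mono[of j "max i j" V] by auto
    then show "p = q" using inj_on_expand_polys_le pq(3) by (auto dest: inj_onD)
  qed
qed

lemma expand_monomial_mult:
  assumes "\<And>m. adapted (n + m) = x * adapted m"
  shows "expand (monomial n * p) = x * expand p"
  by (induction p rule: mpoly_induct)
     (auto simp: smul_mult_right smul_mult_left expand.scale expand.add expand.zero
       monomial_add[symmetric] expand_monomial assms distrib_left)

lemma expand_param_mult: "v \<in> V - Z \<Longrightarrow> expand (indet v * p) = \<pi> v * expand p"
  unfolding indet_eq_monomial by (rule expand_monomial_mult[OF adapted_add_param])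

text \<open>
Membership in the monomial ideal generated by the squares of \<open>Z\<close> and the variables in \<open>T\<close>.
\<close>

definition killed :: "'v set \<Rightarrow> ('v \<Rightarrow>\<^sub>0 nat) \<Rightarrow> bool" where
  "killed T m \<longleftrightarrow> (\<exists>z\<in>Z. 2 \<le> Poly_Mapping.lookup m z) \<or> (\<exists>v\<in>T. 1 \<le> Poly_Mapping.lookup m v)"

definition killed_polys :: "'v set \<Rightarrow> ('v, 'k) mpoly set" where
  "killed_polys T = {p \<in> carrier (poly_ring V). \<forall>m\<in>Poly_Mapping.keys p. killed T m}"

definition relations :: "'v set \<Rightarrow> ('v, 'k) mpoly set" where
  "relations T = c ` Z \<union> \<pi> ` T"

lemma killed_add: "killed T m \<Longrightarrow> killed T (m' + m)"
  unfolding killed_def by (auto simp: lookup_add intro: trans_le_add2)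

lemma relations_subset_carrier:
  assumes "T \<subseteq> V - Z"
  shows "relations T \<subseteq> carrier (poly_ring V)"
proof -
  have "c z \<in> carrier (poly_ring V)" if "z \<in> Z" for z
    using c_deg[OF that] by (rule subsetD[OF polys_le_subset_carrier])
  moreover have "\<pi> v \<in> carrier (poly_ring V)" if "v \<in> V - Z" for v
    using param_deg[OF that] by (rule subsetD[OF polys_le_subset_carrier])
  ultimately show ?thesis using assms by (auto simp: relations_def)
qed

lemma subspace_killed_polys: "mp.subspace (killed_polys T)"
proof (rule mp.subspaceI)
  note sub = subspace_poly_ring[of V, where 'k = 'k]
  show "0 \<in> killed_polys T" using mp.subspace_0[OF sub] by (simp add: killed_polys_def)
  show "p + q \<in> killed_polys T" if "p \<in> killed_polys T" "q \<in> killed_polys T" for p q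
    using that mp.subspace_add[OF sub] Poly_Mapping.keys_add[of p q]
    unfolding killed_polys_def by auto
  show "smul a p \<in> killed_polys T" if "p \<in> killed_polys T" for a p
    using that mp.subspace_scale[OF sub]
    unfolding killed_polys_def by (auto simp: in_keys_iff lookup_smul)
qed

lemma killed_polys_mult:
  assumes "p \<in> killed_polys T" "q \<in> carrier (poly_ring V)"
  shows "q * p \<in> killed_polys T"
proof -
  have "killed T m" if "m \<in> Poly_Mapping.keys (q * p)" for m
    using that Poly_Mapping.keys_mult[of q p] assms(1) killed_add
    unfolding killed_polys_def by blast
  then show ?thesis
    using assms poly_ring_mult_closed by (auto simp: killed_polys_def)
qed

lemma monomial_in_carrier_iff: "monomial m \<in> carrier (poly_ring V) \<longleftrightarrow> Poly_Mapping.keys m \<subseteq> V"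
  by (simp add: monomial_def poly_ring_def)

lemma monomial_in_killed_polys_iff:
  "monomial m \<in> killed_polys T \<longleftrightarrow> Poly_Mapping.keys m \<subseteq> V \<and> killed T m"
  by (simp add: killed_polys_def monomial_in_carrier_iff) (simp add: monomial_def)

lemma adapted_in_carrier: "Poly_Mapping.keys m \<subseteq> V \<Longrightarrow> adapted m \<in> carrier (poly_ring V)"
  using adapted_deg by (rule subsetD[OF polys_le_subset_carrier])

text \<open>
A killed monomial is divisible by a generator \<open>n\<close> of the monomial ideal; on adapted products,
multiplication by \<open>n\<close> becomes multiplication by a relation \<open>g\<close>.
\<close>

lemma killed_cases:
  assumes "T \<subseteq> V - Z" "killed T m"
  obtains g m' n where "g \<in> relations T" "m = n + m'" "\<And>m. adapted (n + m) = g * adapted m"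
    "killed T n"
proof -
  from assms(2) consider z where "z \<in> Z" "2 \<le> Poly_Mapping.lookup m z"
    | v where "v \<in> T" "1 \<le> Poly_Mapping.lookup m v" unfolding killed_def by auto
  then show thesis
  proof cases
    case 1
    have "m = Poly_Mapping.single z 2 + (m - Poly_Mapping.single z 2)"
      using 1 by (intro poly_mapping_eqI) (auto simp: lookup_add lookup_minus lookup_single when_def)
    then show thesis using 1(1) adapted_add_square[OF 1(1)]
      by (intro that[of "c z"]) (auto simp: relations_def killed_def intro!: disjI1 bexI[of _ z])
  next
    case 2
    have "m = Poly_Mapping.single v 1 + (m - Poly_Mapping.single v 1)"
      using 2 by (intro poly_mapping_eqI) (auto simp: lookup_add lookup_minus lookup_single when_def)
    then show thesis using 2(1) adapted_add_param[of v] assms(1)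
      by (intro that[of "\<pi> v"]) (auto simp: relations_def killed_def intro!: disjI2 bexI[of _ v])
  qed
qed

text \<open>
Every killed monomial is mapped to a multiple of a relation, which gives one inclusion. For the other,
the image is an ideal: if \<open>m = n + m'\<close> with a generator \<open>n\<close> and relation \<open>g\<close>, then \<open>p\<close> times the image of
\<open>m\<close> is \<open>g * (p * adapted m')\<close>, and the second factor is some \<open>expand r\<close> by surjectivity, so the product
is the image of \<open>n\<close> times \<open>r\<close>.
\<close>

lemma genideal_relations_eq:
  assumes T: "T \<subseteq> V - Z"
  shows "genideal (poly_ring V) (relations T) = expand ` killed_polys T"
proof
  let ?R = "poly_ring V :: ('v, 'k) mpoly ring"
  interpret R: cring ?R by (rule cring_poly_ring)
  note G = relations_subset_carrier[OF T]
  interpret I: ideal "genideal ?R (relations T)" ?R by (rule R.genideal_ideal[OF G])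
  have I_add: "p + q \<in> genideal ?R (relations T)"
    if "p \<in> genideal ?R (relations T)" "q \<in> genideal ?R (relations T)" for p q
    using I.a_closed[OF that] by (simp add: poly_ring_simps)
  have I_mult: "q * p \<in> genideal ?R (relations T)"
    if "p \<in> genideal ?R (relations T)" "q \<in> carrier ?R" for p q
    using I.I_l_closed[OF that] by (simp add: poly_ring_simps)
  have adapted_killed: "adapted m \<in> genideal ?R (relations T)" if m: "Poly_Mapping.keys m \<subseteq> V" "killed T m" for m
  proof -
    obtain g m' n where gm: "g \<in> relations T" "m = n + m'" "\<And>m. adapted (n + m) = g * adapted m" "killed T n"
      by (rule killed_cases[OF T m(2)]) (rule that)
    have "Poly_Mapping.keys m' \<subseteq> Poly_Mapping.keys m"
      by (auto simp: gm(2) in_keys_iff lookup_add)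
    then have "adapted m' * g \<in> genideal ?R (relations T)"
      using m R.genideal_self[OF G] gm(1) by (intro I_mult adapted_in_carrier) auto
    then show ?thesis by (simp add: gm(2,3) mult.commute)
  qed
  show "expand ` killed_polys T \<subseteq> genideal ?R (relations T)"
  proof (rule image_subsetI)
    fix p assume p: "p \<in> killed_polys T"
    show "expand p \<in> genideal ?R (relations T)"
    proof (rule mpoly_induct[of p "\<lambda>p. expand p \<in> genideal ?R (relations T)"])
      show "expand 0 \<in> genideal ?R (relations T)"
        using I.zero_closed by (simp add: expand.zero poly_ring_simps)
      show "expand (p + q) \<in> genideal ?R (relations T)"
        if "expand p \<in> genideal ?R (relations T)" "expand q \<in> genideal ?R (relations T)" for p q
        using I_add[OF that] by (simp add: expand.add)
      show "expand (smul a (monomial m)) \<in> genideal ?R (relations T)"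
        if "m \<in> Poly_Mapping.keys p" for m a
      proof -
        have "Poly_Mapping.keys m \<subseteq> V" "killed T m"
          using p that by (auto simp: killed_polys_def poly_ring_def)
        moreover have "Poly_Mapping.single 0 a \<in> carrier ?R" by (simp add: poly_ring_def)
        ultimately show ?thesis
          unfolding expand.scale expand_monomial using I_mult[OF adapted_killed] unfolding smul_def by simp
      qed
    qed
  qed
  have expand_surj: "\<exists>q\<in>carrier ?R. p = expand q" if "p \<in> carrier ?R" for p
    using that bij_betw_expand unfolding bij_betw_def by blast
  have mult: "p * expand q \<in> expand ` killed_polys T"
    if p: "p \<in> carrier ?R" and q: "q \<in> killed_polys T" for p q
  proof (rule mpoly_induct[of q "\<lambda>q. p * expand q \<in> expand ` killed_polys T"])
    show "p * expand 0 \<in> expand ` killed_polys T"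
      using mp.subspace_0[OF subspace_killed_polys] by (auto simp: expand.zero intro!: image_eqI[of _ _ 0])
    show "p * expand (q + r) \<in> expand ` killed_polys T"
      if "p * expand q \<in> expand ` killed_polys T" "p * expand r \<in> expand ` killed_polys T" for q r
      using that mp.subspace_add[OF expand.subspace_image[OF subspace_killed_polys]]
      by (simp add: expand.add distrib_left)
    show "p * expand (smul a (monomial m)) \<in> expand ` killed_polys T"
      if m: "m \<in> Poly_Mapping.keys q" for a m
    proof -
      have mk: "Poly_Mapping.keys m \<subseteq> V" "killed T m"
        using q m by (auto simp: killed_polys_def poly_ring_def)
      obtain g m' n where gm: "g \<in> relations T" "m = n + m'" "\<And>m. adapted (n + m) = g * adapted m" "killed T n"
        by (rule killed_cases[OF T mk(2)]) (rule that)
      have n: "monomial n \<in> killed_polys T" and m': "Poly_Mapping.keys m' \<subseteq> V"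
        using mk(1) gm(2,4) by (auto simp: monomial_in_killed_polys_iff in_keys_iff lookup_add subset_iff)
      have "p * adapted m' \<in> carrier ?R" using p adapted_in_carrier[OF m'] by (rule poly_ring_mult_closed)
      then obtain r where r: "r \<in> carrier ?R" "p * adapted m' = expand r" using expand_surj by auto
      have "p * expand (smul a (monomial m)) = smul a (g * expand r)"
        by (simp add: expand.scale expand_monomial gm(2,3) smul_mult_right r(2)[symmetric] mult_ac)
      also have "\<dots> = expand (smul a (monomial n * r))"
        by (simp add: expand.scale expand_monomial_mult[OF gm(3)])
      finally have e: "p * expand (smul a (monomial m)) = expand (smul a (monomial n * r))" .
      have "smul a (monomial n * r) \<in> killed_polys T"
        using killed_polys_mult[OF n r(1)] mp.subspace_scale[OF subspace_killed_polys]
        by (simp add: mult.commute)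
      then show ?thesis unfolding e by (rule imageI)
    qed
  qed
  note W = expand.subspace_image[OF subspace_killed_polys, of T]
  have "ideal (expand ` killed_polys T) ?R"
  proof (rule idealI[OF R.ring_axioms])
    have sub: "expand ` killed_polys T \<subseteq> carrier ?R"
      using bij_betw_expand unfolding bij_betw_def killed_polys_def by blast
    show "subgroup (expand ` killed_polys T) (add_monoid ?R)"
    proof (rule R.add.subgroupI)
      fix p q assume p: "p \<in> expand ` killed_polys T"
      have "\<ominus>\<^bsub>?R\<^esub> p = - p"
        using sub p mp.subspace_neg[OF W p] by (intro R.minus_equality) (auto simp: poly_ring_simps)
      then show "\<ominus>\<^bsub>?R\<^esub> p \<in> expand ` killed_polys T"
        using mp.subspace_neg[OF W p] by simp
      show "p \<oplus>\<^bsub>?R\<^esub> q \<in> expand ` killed_polys T" if "q \<in> expand ` killed_polys T"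
        using mp.subspace_add[OF W p that] by (simp add: poly_ring_simps)
    qed (use sub mp.subspace_0[OF W] in auto)
  qed (use mult in \<open>auto simp: poly_ring_simps mult.commute\<close>)
  moreover have "relations T \<subseteq> expand ` killed_polys T"
  proof
    fix g assume "g \<in> relations T"
    then consider z where "z \<in> Z" "g = c z" | v where "v \<in> T" "g = \<pi> v"
      by (auto simp: relations_def)
    then show "g \<in> expand ` killed_polys T"
    proof cases
      case 1
      then have "expand (monomial (Poly_Mapping.single z 2)) = g"
        using adapted_add_square[of z 0] by (simp add: expand_monomial adapted_zero)
      moreover have "monomial (Poly_Mapping.single z 2) \<in> killed_polys T"
        using 1 Z_subset by (auto simp: monomial_in_killed_polys_iff killed_def intro!: disjI1 bexI[of _ z])
      ultimately show ?thesis by (metis imageI)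
    next
      case 2
      then have "expand (monomial (Poly_Mapping.single v 1)) = g"
        using adapted_add_param[of v 0] T by (auto simp: expand_monomial adapted_zero)
      moreover have "monomial (Poly_Mapping.single v 1) \<in> killed_polys T"
        using 2 T by (auto simp: monomial_in_killed_polys_iff killed_def intro!: disjI2 bexI[of _ v])
      ultimately show ?thesis by (metis imageI)
    qed
  qed
  ultimately show "genideal ?R (relations T) \<subseteq> expand ` killed_polys T"
    by (rule R.genideal_minimal)
qed

text \<open>
Under \<open>expand\<close> the claim becomes that the variable \<open>v\<close> is regular modulo a monomial ideal whose
generators do not involve \<open>v\<close>: a monomial is killed as soon as its product with \<open>v\<close> is.
\<close>

lemma param_nonzerodivisor:
  assumes T: "T \<subseteq> V - Z" and v: "v \<in> V - Z" "v \<notin> T"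
    and p: "p \<in> carrier (poly_ring V)" "\<pi> v * p \<in> genideal (poly_ring V) (relations T)"
  shows "p \<in> genideal (poly_ring V) (relations T)"
proof -
  obtain q where q: "q \<in> carrier (poly_ring V)" "p = expand q"
    using p(1) bij_betw_expand unfolding bij_betw_def by blast
  obtain r where r: "r \<in> killed_polys T" "\<pi> v * p = expand r"
    using p(2) unfolding genideal_relations_eq[OF T] by auto
  have "indet v * q \<in> carrier (poly_ring V)"
    using v q(1) by (intro poly_ring_mult_closed) (auto simp: indet_def poly_ring_def)
  moreover have "expand (indet v * q) = expand r"
    using expand_param_mult[OF v(1), of q] q(2) r(2) by simp
  ultimately have eq: "indet v * q = r"
    using bij_betw_expand r(1) unfolding bij_betw_def killed_polys_def by (auto dest: inj_onD)
  have "killed T m" if m: "m \<in> Poly_Mapping.keys q" for m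
  proof -
    have "Poly_Mapping.single v 1 + m \<in> Poly_Mapping.keys r"
      using m eq lookup_monomial_mult[of "Poly_Mapping.single v 1" q m]
      by (simp add: in_keys_iff indet_eq_monomial)
    then have "killed T (Poly_Mapping.single v 1 + m)" using r(1) by (auto simp: killed_polys_def)
    then show "killed T m"
      using v by (auto simp: killed_def lookup_add lookup_single when_def split: if_splits)
  qed
  then show ?thesis
    unfolding genideal_relations_eq[OF T] q(2) using q(1) by (auto simp: killed_polys_def)
qed

lemma one_notin_genideal_relations:
  assumes T: "T \<subseteq> V - Z"
  shows "1 \<notin> genideal (poly_ring V) (relations T)"
proof
  assume "1 \<in> genideal (poly_ring V) (relations T)"
  then obtain p where p: "p \<in> killed_polys T" "expand p = expand (monomial 0)"
    unfolding genideal_relations_eq[OF T] by (auto simp: expand_monomial adapted_zero)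
  have "monomial 0 \<in> carrier (poly_ring V)" by (simp add: monomial_in_carrier_iff)
  then have "p = monomial 0"
    using p bij_betw_expand unfolding bij_betw_def killed_polys_def by (auto dest: inj_onD)
  then show False using p(1) by (simp add: monomial_in_killed_polys_iff killed_def)
qed

text \<open>
The monomials that give a basis of the quotient in degree at most \<open>d\<close>. Their exponents at \<open>Z\<close> are \<open>0\<close>
or \<open>1\<close>, so their number grows at most like \<open>d\<^sup>N\<close> if \<open>N\<close> parameters are not killed.
\<close>

definition survivors :: "'v set \<Rightarrow> nat \<Rightarrow> ('v \<Rightarrow>\<^sub>0 nat) set" where
  "survivors T d = {m \<in> monomials_le V d. \<not> killed T m}"

lemma reduce_mod_relations:
  assumes T: "T \<subseteq> V - Z" and p: "p \<in> polys_le V d"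
  shows "\<exists>r\<in>mp.span (adapted ` survivors T d). p - r \<in> genideal (poly_ring V) (relations T)"
proof -
  obtain q where q: "q \<in> polys_le V d" "p = expand q"
    using p expand_image_polys_le_eq by blast
  let ?K = "{m \<in> Poly_Mapping.keys q. killed T m}" and ?S = "{m \<in> Poly_Mapping.keys q. \<not> killed T m}"
  let ?f = "\<lambda>m. smul (Poly_Mapping.lookup q m) (adapted m)"
  have q_keys: "Poly_Mapping.keys q \<subseteq> monomials_le V d" using q(1) by (simp add: polys_le_def)
  have "Poly_Mapping.keys q = ?K \<union> ?S" by auto
  then have "p = sum ?f (?K \<union> ?S)" using q(2) by (simp add: expand_def)
  also have "\<dots> = sum ?f ?K + sum ?f ?S" by (rule sum.union_disjoint) auto
  finally have "p - sum ?f ?S = sum ?f ?K" by simp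
  also have "\<dots> = (\<Sum>m\<in>?K. expand (smul (Poly_Mapping.lookup q m) (monomial m)))"
    by (simp add: expand.scale expand_monomial)
  also have "\<dots> = expand (\<Sum>m\<in>?K. smul (Poly_Mapping.lookup q m) (monomial m))"
    by (simp add: expand.sum)
  also have "\<dots> \<in> genideal (poly_ring V) (relations T)"
    unfolding genideal_relations_eq[OF T] using q_keys
    by (intro imageI mp.subspace_sum[OF subspace_killed_polys] mp.subspace_scale[OF subspace_killed_polys])
       (auto simp: monomial_in_killed_polys_iff monomials_le_def)
  finally have "p - sum ?f ?S \<in> genideal (poly_ring V) (relations T)" .
  moreover have "sum ?f ?S \<in> mp.span (adapted ` survivors T d)"
    using q_keys by (intro mp.span_sum mp.span_scale mp.span_base) (auto simp: survivors_def)
  ultimately show ?thesis by blast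
qed

lemma
  assumes T: "T \<subseteq> V - Z"
  shows finite_survivors: "finite (survivors T d)"
    and card_survivors: "card (survivors T d) \<le> 2 ^ card Z * Suc d ^ card (V - Z - T)"
proof -
  \<comment> \<open>Largest exponent that a surviving monomial can have at \<open>v\<close>.\<close>
  let ?u = "\<lambda>v. if v \<in> Z then 1 else if v \<in> T then 0 else d"
  let ?B = "{m. Poly_Mapping.keys m \<subseteq> V \<and> (\<forall>v\<in>V. Poly_Mapping.lookup m v \<le> ?u v)}"
  have sub: "survivors T d \<subseteq> ?B"
  proof
    fix m assume m: "m \<in> survivors T d"
    have "Poly_Mapping.lookup m v \<le> ?u v" for v
      using m lookup_le_total_degree[of m v]
      by (auto simp: survivors_def monomials_le_def killed_def not_le)
    then show "m \<in> ?B" using m by (auto simp: survivors_def monomials_le_def)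
  qed
  then show "finite (survivors T d)" using finite_box[OF finite_V] by (rule finite_subset)
  have "card (survivors T d) \<le> card ?B" by (rule card_mono[OF finite_box[OF finite_V] sub])
  also have "\<dots> \<le> (\<Prod>v\<in>V. Suc (?u v))" by (rule card_box[OF finite_V])
  also have "\<dots> = (\<Prod>v\<in>V - Z. Suc (?u v)) * (\<Prod>v\<in>Z. Suc (?u v))"
    by (rule prod.subset_diff[OF Z_subset finite_V])
  also have "(\<Prod>v\<in>V - Z. Suc (?u v)) = (\<Prod>v\<in>V - Z - T. Suc (?u v)) * (\<Prod>v\<in>T. Suc (?u v))"
    by (rule prod.subset_diff[OF T finite_sets(2)])
  also have "(\<Prod>v\<in>T. Suc (?u v)) = 1" using T by (intro prod.neutral) auto
  also have "(\<Prod>v\<in>V - Z - T. Suc (?u v)) = (\<Prod>v\<in>V - Z - T. Suc d)" by (rule prod.cong) auto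
  also have "(\<Prod>v\<in>Z. Suc (?u v)) = (\<Prod>v\<in>Z. 2)" by (rule prod.cong) auto
  finally show "card (survivors T d) \<le> 2 ^ card Z * Suc d ^ card (V - Z - T)"
    by (simp add: mult.commute)
qed

end

section \<open>Algebraic relations bound chains of primes\<close>

lemma (in vector_space) exists_nontrivial_relation:
  assumes S: "finite S" "y ` E \<subseteq> span S" and E: "finite E" "card S < card E"
  shows "\<exists>a. (\<exists>\<alpha>\<in>E. a \<alpha> \<noteq> 0) \<and> (\<Sum>\<alpha>\<in>E. a \<alpha> *s y \<alpha>) = 0"
proof (cases "inj_on y E")
  case True
  have "dependent (y ` E)"
    using independent_span_bound[OF S(1) _ S(2)] E(2) card_image[OF True] by auto
  then obtain u where u: "\<exists>v\<in>y ` E. u v \<noteq> 0" "(\<Sum>v\<in>y ` E. u v *s v) = 0"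
    using E(1) by (subst (asm) dependent_finite) auto
  then show ?thesis
    by (intro exI[of _ "\<lambda>\<alpha>. u (y \<alpha>)"]) (auto simp: sum.reindex[OF True] comp_def)
next
  case False
  then obtain \<alpha> \<beta> where ab: "\<alpha> \<in> E" "\<beta> \<in> E" "\<alpha> \<noteq> \<beta>" "y \<alpha> = y \<beta>" by (auto simp: inj_on_def)
  let ?a = "\<lambda>\<gamma>. if \<gamma> = \<alpha> then 1 else if \<gamma> = \<beta> then - 1 else 0"
  have "(\<Sum>\<gamma>\<in>E. ?a \<gamma> *s y \<gamma>) = (\<Sum>\<gamma>\<in>{\<alpha>, \<beta>}. ?a \<gamma> *s y \<gamma>)"
    using ab E(1) by (intro sum.mono_neutral_right) auto
  also have "\<dots> = 0" using ab by simp
  finally show ?thesis using ab(1) by (intro exI[of _ ?a]) auto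
qed

text \<open>
Exponents are lists, so that splitting off the first factor is structural recursion; this matches the
induction along a chain of primes, which removes its bottom element.
\<close>

fun power_product :: "(nat \<Rightarrow> 'a::comm_monoid_mult) \<Rightarrow> nat list \<Rightarrow> 'a" where
  "power_product x [] = 1"
| "power_product x (k # ks) = x 0 ^ k * power_product (\<lambda>i. x (Suc i)) ks"

lemma power_product_deg:
  assumes "\<And>i. i < length ks \<Longrightarrow> x i \<in> polys_le V e"
  shows "power_product x ks \<in> polys_le V (sum_list ks * e)"
  using assms
proof (induction ks arbitrary: x)
  case (Cons k ks)
  have "x 0 ^ k \<in> polys_le V (k * e)" using Cons.prems by (intro polys_le_power) auto
  moreover have "power_product (\<lambda>i. x (Suc i)) ks \<in> polys_le V (sum_list ks * e)"
    using Cons.prems by (intro Cons.IH) auto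
  ultimately show ?case by (auto dest: polys_le_mult simp: distrib_right)
qed (simp add: one_in_polys_le)

lemma
  assumes "ideal P (poly_ring V :: ('v, 'k::field) mpoly ring)"
  shows ideal_poly_ring_subspace: "mp.subspace P"
    and ideal_poly_ring_mult: "p \<in> P \<Longrightarrow> q \<in> carrier (poly_ring V) \<Longrightarrow> q * p \<in> P"
proof -
  interpret ideal P "poly_ring V" by (rule assms)
  show mult: "q * p \<in> P" if "p \<in> P" "q \<in> carrier (poly_ring V)" for p q
    using I_l_closed[OF that] by (simp add: poly_ring_simps)
  show "mp.subspace P"
  proof (rule mp.subspaceI)
    show "0 \<in> P"
      using additive_subgroup.zero_closed[OF is_additive_subgroup] by (simp add: poly_ring_simps)
    show "p + q \<in> P" if "p \<in> P" "q \<in> P" for p q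
      using additive_subgroup.a_closed[OF is_additive_subgroup that] by (simp add: poly_ring_simps)
    show "smul a p \<in> P" if "p \<in> P" for a p
      unfolding smul_def by (rule mult[OF that]) (simp add: poly_ring_def)
  qed
qed

lemma power_product_in_carrier:
  assumes "\<And>i. i < length ks \<Longrightarrow> x i \<in> carrier (poly_ring V)"
  shows "power_product x ks \<in> carrier (poly_ring V)"
  using assms
proof (induction ks arbitrary: x)
  case (Cons k ks)
  have "x 0 ^ k \<in> carrier (poly_ring V)"
    using Cons.prems[of 0] by (induction k) (auto intro: poly_ring_mult_closed, simp add: poly_ring_def)
  moreover have "power_product (\<lambda>i. x (Suc i)) ks \<in> carrier (poly_ring V)"
    using Cons.prems by (intro Cons.IH) auto
  ultimately show ?case by (simp add: poly_ring_mult_closed)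
qed (simp add: poly_ring_def)

text \<open>
Take the terms of the relation in which \<open>x\<^sub>0\<close> has its least exponent \<open>r\<close>. Since \<open>x\<^sub>0 \<notin> P\<^sub>0\<close>, the factor
\<open>x\<^sub>0\<^sup>r\<close> cancels modulo the prime \<open>P\<^sub>0\<close>; the other terms still contain \<open>x\<^sub>0 \<in> P\<^sub>1\<close>. What remains
is a nontrivial relation in \<open>x\<^sub>1, x\<^sub>2, \<dots>\<close> that holds modulo \<open>P\<^sub>1\<close>. In the end a nonzero constant would lie
in a prime ideal.
\<close>

lemma relation_notin_bottom_of_chain:
  fixes x :: "nat \<Rightarrow> ('v, 'k::field) mpoly"
  assumes "\<And>i. i \<le> k \<Longrightarrow> primeideal (P i) (poly_ring V)"
    and "\<And>i. i < k \<Longrightarrow> P i \<subseteq> P (Suc i)" and "\<And>i. i < k \<Longrightarrow> x i \<in> P (Suc i) - P i"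
    and "finite E" "\<And>\<alpha>. \<alpha> \<in> E \<Longrightarrow> length \<alpha> = k" "\<exists>\<alpha>\<in>E. a \<alpha> \<noteq> 0"
  shows "(\<Sum>\<alpha>\<in>E. smul (a \<alpha>) (power_product x \<alpha>)) \<notin> P 0"
  using assms
proof (induction k arbitrary: P x E a)
  case 0
  let ?R = "poly_ring V :: ('v, 'k) mpoly ring"
  interpret P: primeideal "P 0" ?R using 0(1) by simp
  have E: "E = {[]}" "a [] \<noteq> 0" using 0(5,6) by auto
  show ?case
  proof
    assume "(\<Sum>\<alpha>\<in>E. smul (a \<alpha>) (power_product x \<alpha>)) \<in> P 0"
    then have "smul (a []) 1 \<in> P 0" using E(1) by simp
    then have "smul (inverse (a [])) (smul (a []) 1) \<in> P 0"
      by (rule mp.subspace_scale[OF ideal_poly_ring_subspace[OF P.is_ideal]])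
    then have "\<one>\<^bsub>?R\<^esub> \<in> P 0" using E(2) by (simp add: poly_ring_simps)
    then show False using P.one_imp_carrier P.I_notcarr by auto
  qed
next
  case (Suc k)
  let ?R = "poly_ring V :: ('v, 'k) mpoly ring"
  let ?x = "\<lambda>i. x (Suc i)"
  interpret P0: primeideal "P 0" ?R using Suc.prems(1) by simp
  interpret P1: primeideal "P (Suc 0)" ?R using Suc.prems(1) by simp
  note S0 = ideal_poly_ring_subspace[OF P0.is_ideal] and S1 = ideal_poly_ring_subspace[OF P1.is_ideal]
  have x_carr: "x i \<in> carrier ?R" if "i < Suc k" for i
    using Suc.prems(3)[OF that] ideal.Icarr[OF primeideal.axioms(1)[OF Suc.prems(1)[of "Suc i"]]] that
    by auto
  define E' where "E' = {\<alpha> \<in> E. a \<alpha> \<noteq> 0}"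
  have E': "finite E'" "E' \<noteq> {}" using Suc.prems(4,6) unfolding E'_def by auto
  define r where "r = Min (hd ` E')"
  have r_le: "r \<le> hd \<alpha>" if "\<alpha> \<in> E'" for \<alpha>
    unfolding r_def using that E' by (intro Min_le) auto
  have "r \<in> hd ` E'" unfolding r_def using E' by (intro Min_in) auto
  then obtain \<alpha>0 where \<alpha>0: "\<alpha>0 \<in> E'" "hd \<alpha>0 = r" by auto
  have cons: "\<alpha> = hd \<alpha> # tl \<alpha>" "length (tl \<alpha>) = k" if "\<alpha> \<in> E'" for \<alpha>
    using Suc.prems(5)[of \<alpha>] that unfolding E'_def by (cases \<alpha>; auto)+
  define g where "g \<alpha> = smul (a \<alpha>) (x 0 ^ (hd \<alpha> - r) * power_product ?x (tl \<alpha>))" for \<alpha>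
  have pp_carr: "power_product ?x (tl \<alpha>) \<in> carrier ?R" if "\<alpha> \<in> E'" for \<alpha>
    using cons[OF that] x_carr by (intro power_product_in_carrier) auto
  have pow_carr: "x 0 ^ j \<in> carrier ?R" for j
    using power_product_in_carrier[of "[j]" x V] x_carr by simp
  have g_carr: "g \<alpha> \<in> carrier ?R" if "\<alpha> \<in> E'" for \<alpha>
    unfolding g_def using that pp_carr pow_carr
    by (intro mp.subspace_scale[OF subspace_poly_ring] poly_ring_mult_closed)
  have sum_eq: "(\<Sum>\<alpha>\<in>E. smul (a \<alpha>) (power_product x \<alpha>)) = x 0 ^ r * sum g E'"
  proof -
    have "(\<Sum>\<alpha>\<in>E. smul (a \<alpha>) (power_product x \<alpha>)) = (\<Sum>\<alpha>\<in>E'. smul (a \<alpha>) (power_product x \<alpha>))"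
      unfolding E'_def using Suc.prems(4) by (intro sum.mono_neutral_right) auto
    also have "\<dots> = (\<Sum>\<alpha>\<in>E'. x 0 ^ r * g \<alpha>)"
    proof (rule sum.cong[OF refl])
      fix \<alpha> assume \<alpha>: "\<alpha> \<in> E'"
      have "power_product x \<alpha> = x 0 ^ hd \<alpha> * power_product ?x (tl \<alpha>)"
        by (subst cons(1)[OF \<alpha>]) simp
      also have "x 0 ^ hd \<alpha> = x 0 ^ r * x 0 ^ (hd \<alpha> - r)"
        using r_le[OF \<alpha>] by (simp add: power_add[symmetric])
      finally show "smul (a \<alpha>) (power_product x \<alpha>) = x 0 ^ r * g \<alpha>"
        by (simp add: g_def smul_mult_right mult.assoc)
    qed
    finally show ?thesis by (simp add: sum_distrib_left)
  qed
  have cancel: "q \<in> P 0" if "x 0 ^ j * q \<in> P 0" "q \<in> carrier ?R" for j q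
    using that
  proof (induction j)
    case (Suc j)
    have "x 0 * (x 0 ^ j * q) \<in> P 0" using Suc.prems by (simp add: mult.assoc)
    then have "x 0 ^ j * q \<in> P 0"
      using P0.I_prime[of "x 0" "x 0 ^ j * q"] Suc.prems(2) \<open>\<And>i. i < Suc k \<Longrightarrow> x i \<in> P (Suc i) - P i\<close>[of 0]
        x_carr[of 0] pow_carr poly_ring_mult_closed by (auto simp: poly_ring_simps)
    then show ?case using Suc by simp
  qed simp
  show ?case
  proof
    assume "(\<Sum>\<alpha>\<in>E. smul (a \<alpha>) (power_product x \<alpha>)) \<in> P 0"
    moreover have "sum g E' \<in> carrier ?R"
      by (rule mp.subspace_sum[OF subspace_poly_ring g_carr])
    ultimately have "sum g E' \<in> P 0" unfolding sum_eq by (rule cancel)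
    then have sum1: "sum g E' \<in> P (Suc 0)" by (rule subsetD[OF Suc.prems(2)[OF zero_less_Suc]])
    let ?lo = "{\<alpha> \<in> E'. hd \<alpha> = r}" and ?hi = "{\<alpha> \<in> E'. hd \<alpha> \<noteq> r}"
    have "g \<alpha> \<in> P (Suc 0)" if \<alpha>: "\<alpha> \<in> ?hi" for \<alpha>
    proof -
      obtain j where "hd \<alpha> - r = Suc j" using \<alpha> r_le[of \<alpha>] by (cases "hd \<alpha> - r") auto
      then have "x 0 ^ (hd \<alpha> - r) * power_product ?x (tl \<alpha>)
        = (x 0 ^ j * power_product ?x (tl \<alpha>)) * x 0"
        by (simp add: mult_ac)
      also have "\<dots> \<in> P (Suc 0)"
        using Suc.prems(3)[of 0] \<alpha> poly_ring_mult_closed[OF pow_carr pp_carr]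
        by (intro ideal_poly_ring_mult[OF P1.is_ideal]) auto
      finally show ?thesis unfolding g_def by (rule mp.subspace_scale[OF S1])
    qed
    then have "sum g ?hi \<in> P (Suc 0)" by (rule mp.subspace_sum[OF S1])
    moreover have "sum g E' = sum g ?lo + sum g ?hi"
      using E'(1) by (subst sum.union_disjoint[symmetric]) (auto intro: sum.cong)
    ultimately have "sum g ?lo \<in> P (Suc 0)"
      using mp.subspace_diff[OF S1 sum1, of "sum g ?hi"] by simp
    moreover have "sum g ?lo = (\<Sum>\<beta>\<in>tl ` ?lo. smul (a (r # \<beta>)) (power_product ?x \<beta>))"
    proof -
      have "inj_on tl ?lo" 
      proof (rule inj_onI)
        fix \<alpha> \<beta> assume "\<alpha> \<in> ?lo" "\<beta> \<in> ?lo" "tl \<alpha> = tl \<beta>"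
        then show "\<alpha> = \<beta>" using cons(1)[of \<alpha>] cons(1)[of \<beta>] by simp
      qed
      moreover have "g \<alpha> = smul (a (r # tl \<alpha>)) (power_product ?x (tl \<alpha>))" if "\<alpha> \<in> ?lo" for \<alpha>
        using that cons(1)[of \<alpha>] unfolding g_def by auto
      ultimately show ?thesis by (simp add: sum.reindex)
    qed
    moreover have "(\<Sum>\<beta>\<in>tl ` ?lo. smul (a (r # \<beta>)) (power_product ?x \<beta>)) \<notin> P (Suc 0)"
    proof (rule Suc.IH[of "\<lambda>i. P (Suc i)"])
      have "r # tl \<alpha>0 = \<alpha>0" using cons(1)[OF \<alpha>0(1)] \<alpha>0(2) by simp
      then show "\<exists>\<beta>\<in>tl ` ?lo. a (r # \<beta>) \<noteq> 0"
        using \<alpha>0 unfolding E'_def by (intro bexI[of _ "tl \<alpha>0"]) auto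
      show "length \<beta> = k" if "\<beta> \<in> tl ` ?lo" for \<beta> using that cons(2) by auto
    qed (use Suc.prems E'(1) in auto)
    ultimately show False by simp
  qed
qed

context monic_quadratic_system
begin

text \<open>
If the chain were longer than the number \<open>N\<close> of remaining parameters, there would be elements
\<open>x\<^sub>0, \<dots>, x\<^sub>N\<close> along it, all of degree at most some \<open>e\<close>. The \<open>(D + 1)\<^sup>N\<^sup>+\<^sup>1\<close> products with exponents at most
\<open>D\<close> have degree at most \<open>(N + 1) D e\<close>, and modulo the relations they lie in a space whose dimension
grows only like \<open>D\<^sup>N\<close>.
\<close>

lemma chain_length_le:
  assumes T: "T \<subseteq> V - Z"
    and P: "\<And>i. i \<le> k \<Longrightarrow> primeideal (P i) (poly_ring V)" "\<And>i. i < k \<Longrightarrow> P i \<subset> P (Suc i)"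
      "genideal (poly_ring V) (relations T) \<subseteq> P 0"
  shows "k \<le> card (V - Z - T)"
proof (rule ccontr)
  define N where "N = card (V - Z - T)"
  let ?I = "genideal (poly_ring V) (relations T)"
  interpret R: cring "poly_ring V :: ('v, 'k) mpoly ring" by (rule cring_poly_ring)
  assume "\<not> k \<le> card (V - Z - T)"
  then have k: "Suc N \<le> k" unfolding N_def by simp
  have "\<exists>x d. x \<in> P (Suc i) - P i \<and> x \<in> polys_le V d" if "i < Suc N" for i
  proof -
    have "P i \<subset> P (Suc i)" using P(2) k that by simp
    then obtain x where x: "x \<in> P (Suc i)" "x \<notin> P i" by auto
    interpret Pi: primeideal "P (Suc i)" "poly_ring V" using P(1) k that by auto
    obtain d where "x \<in> polys_le V d" using carrier_poly_ring_imp_polys_le[OF Pi.Icarr[OF x(1)]] ..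
    then show ?thesis using x by auto
  qed
  then obtain x d where x: "\<And>i. i < Suc N \<Longrightarrow> x i \<in> P (Suc i) - P i"
    "\<And>i. i < Suc N \<Longrightarrow> x i \<in> polys_le V (d i)" by metis
  define e where "e = Suc (\<Sum>i<Suc N. d i)"
  have xe: "x i \<in> polys_le V e" if "i < Suc N" for i
  proof (rule subsetD[OF polys_le_mono x(2)[OF that]])
    have "d i \<le> (\<Sum>i<Suc N. d i)" using that by (intro member_le_sum) auto
    then show "d i \<le> e" unfolding e_def by simp
  qed
  \<comment> \<open>Chosen so that \<open>2 ^ card Z * (e * Suc N * Suc D) ^ N = D * Suc D ^ N < Suc D ^ Suc N\<close>.\<close>
  define D where "D = 2 ^ card Z * (e * Suc N) ^ N"
  define \<delta> where "\<delta> = Suc N * D * e"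
  define E where "E = {\<alpha>. set \<alpha> \<subseteq> {..D} \<and> length \<alpha> = Suc N}"
  have E: "finite E" "card E = Suc D ^ Suc N"
    using finite_lists_length_eq[of "{..D}" "Suc N"] card_lists_length_eq[of "{..D}" "Suc N"]
    unfolding E_def by auto
  have "\<exists>r\<in>mp.span (adapted ` survivors T \<delta>). power_product x \<alpha> - r \<in> ?I" if \<alpha>: "\<alpha> \<in> E" for \<alpha>
  proof (rule reduce_mod_relations[OF T])
    have "power_product x \<alpha> \<in> polys_le V (sum_list \<alpha> * e)"
      using xe \<alpha> by (intro power_product_deg) (auto simp: E_def)
    moreover have "sum_list \<alpha> \<le> length \<alpha> * D"
      using \<alpha> sum_list_mono[of \<alpha> "\<lambda>x. x" "\<lambda>_. D"] by (auto simp: E_def sum_list_triv)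
    then have "sum_list \<alpha> * e \<le> \<delta>" using \<alpha> by (auto simp: E_def \<delta>_def)
    ultimately show "power_product x \<alpha> \<in> polys_le V \<delta>" using polys_le_mono by blast
  qed
  then obtain y where y: "\<And>\<alpha>. \<alpha> \<in> E \<Longrightarrow> y \<alpha> \<in> mp.span (adapted ` survivors T \<delta>)"
    "\<And>\<alpha>. \<alpha> \<in> E \<Longrightarrow> power_product x \<alpha> - y \<alpha> \<in> ?I" by metis
  have "card (adapted ` survivors T \<delta>) \<le> card (survivors T \<delta>)"
    by (rule card_image_le[OF finite_survivors[OF T]])
  also have "\<dots> \<le> 2 ^ card Z * Suc \<delta> ^ N" unfolding N_def by (rule card_survivors[OF T])
  also have "\<dots> \<le> 2 ^ card Z * (e * Suc N * Suc D) ^ N"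
    by (intro mult_left_mono power_mono) (auto simp: \<delta>_def e_def algebra_simps)
  also have "\<dots> = D * Suc D ^ N" by (simp only: D_def power_mult_distrib mult.assoc)
  also have "\<dots> < Suc D ^ Suc N" by simp
  finally have "card (adapted ` survivors T \<delta>) < card E" using E(2) by simp
  then obtain a where a: "\<exists>\<alpha>\<in>E. a \<alpha> \<noteq> 0" "(\<Sum>\<alpha>\<in>E. smul (a \<alpha>) (y \<alpha>)) = 0"
    using mp.exists_nontrivial_relation[of "adapted ` survivors T \<delta>" y E] y(1) E(1) finite_survivors[OF T] by auto
  have "(\<Sum>\<alpha>\<in>E. smul (a \<alpha>) (power_product x \<alpha>)) = (\<Sum>\<alpha>\<in>E. smul (a \<alpha>) (power_product x \<alpha> - y \<alpha>))"
    using a(2) by (simp add: mp.scale_right_diff_distrib sum_subtractf)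
  also have "\<dots> \<in> ?I"
    using ideal_poly_ring_subspace[OF R.genideal_ideal[OF relations_subset_carrier[OF T]]] y(2)
    by (intro mp.subspace_sum mp.subspace_scale) auto
  finally have "(\<Sum>\<alpha>\<in>E. smul (a \<alpha>) (power_product x \<alpha>)) \<in> P 0" using P(3) by auto
  moreover have "(\<Sum>\<alpha>\<in>E. smul (a \<alpha>) (power_product x \<alpha>)) \<notin> P 0"
    by (rule relation_notin_bottom_of_chain[of "Suc N" P V x E a])
       (use P(1) P(2)[THEN psubset_imp_subset] k x(1) E(1) a(1) in \<open>auto simp: E_def\<close>)
  ultimately show False by simp
qed

end

section \<open>Dimension and regularity of the quotient\<close>

context monic_quadratic_system
begin

lemma genideal_relations_Un:
  assumes "T \<subseteq> V - Z"
  shows "genideal (poly_ring V) (genideal (poly_ring V) (relations {}) \<union> \<pi> ` T)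
    = genideal (poly_ring V) (relations T)"
proof -
  interpret R: cring "poly_ring V :: ('v, 'k) mpoly ring" by (rule cring_poly_ring)
  show ?thesis
    using R.genideal_Un_genideal[of "relations {}" "\<pi> ` T"] relations_subset_carrier[OF assms]
    by (simp add: relations_def)
qed

text \<open>
All three claims are questions about the ideals \<open>K T\<close> of the polynomial ring, generated by the quadrics
and the parameters in \<open>T\<close>: adjoining the next parameter is harmless by \<open>param_nonzerodivisor\<close>, and
\<open>chain_length_le\<close> bounds both dimensions from above, with no parameter killed and with all of them.
\<close>

lemma
  assumes "distinct fs" "set fs = \<pi> ` (V - Z)"
  defines "R \<equiv> poly_ring V" and "J \<equiv> genideal (poly_ring V) (relations {})"
  shows regular_sequence_params: "regular_sequence (R Quot J) (map (\<lambda>f. J +>\<^bsub>R\<^esub> f) fs)"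
    and krull_dim_Quot_relations: "krull_dim (R Quot J) = ereal (real (length fs))"
    and krull_dim_Quot_params:
      "krull_dim (R Quot J Quot genideal (R Quot J) (set (map (\<lambda>f. J +>\<^bsub>R\<^esub> f) fs))) = 0"
proof -
  let ?P = "V - Z" and ?gs = "map (\<lambda>f. J +>\<^bsub>R\<^esub> f) fs"
  define A where "A = R Quot J"
  interpret R: cring R unfolding R_def by (rule cring_poly_ring)
  have rel: "relations T \<subseteq> carrier R" if "T \<subseteq> ?P" for T
    unfolding R_def by (rule relations_subset_carrier[OF that])
  have J: "ideal J R" unfolding J_def R_def[symmetric] by (rule R.genideal_ideal[OF rel]) simp
  interpret J: ideal J R by (rule J)
  interpret A: cring A unfolding A_def by (rule J.quotient_is_cring[OF R.is_cring])
  have \<pi>_carrier: "\<pi> v \<in> carrier R" if "v \<in> ?P" for v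
    using rel[of "{v}"] that by (auto simp: relations_def)
  define I where "I T = genideal A ((+>\<^bsub>R\<^esub>) J ` \<pi> ` T)" for T
  define K where "K T = genideal R (relations T)" for T
  have carrier_A: "carrier A = (+>\<^bsub>R\<^esub>) J ` carrier R" unfolding A_def by (rule carrier_FactRing)
  have I: "ideal (I T) A" if "T \<subseteq> ?P" for T
    unfolding I_def by (rule A.genideal_ideal) (use that \<pi>_carrier in \<open>auto simp: carrier_A\<close>)
  have mem_I: "J +>\<^bsub>R\<^esub> p \<in> I T \<longleftrightarrow> p \<in> K T" if "T \<subseteq> ?P" "p \<in> carrier R" for T p
  proof -
    have "J +>\<^bsub>R\<^esub> p \<in> I T \<longleftrightarrow> p \<in> genideal R (J \<union> \<pi> ` T)"
      unfolding I_def A_def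
      by (rule R.rcos_mem_genideal_Quot_iff[OF J _ that(2)]) (use that \<pi>_carrier in auto)
    then show ?thesis
      unfolding K_def R_def J_def genideal_relations_Un[OF that(1)] .
  qed
  have one: "J +>\<^bsub>R\<^esub> \<one>\<^bsub>R\<^esub> = \<one>\<^bsub>A\<^esub>" unfolding A_def by (simp add: FactRing_def)
  have one_notin: "\<one>\<^bsub>A\<^esub> \<notin> I T" if "T \<subseteq> ?P" for T
    using mem_I[OF that R.one_closed] one_notin_genideal_relations[OF that]
    by (simp add: one) (simp add: K_def R_def poly_ring_simps)

  show regular: "regular_sequence (R Quot J) ?gs"
    unfolding regular_sequence_def Let_def A_def[symmetric]
  proof (intro conjI allI impI)
    show "set ?gs \<subseteq> carrier A" using \<pi>_carrier assms(2) by (auto simp: carrier_A)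
    show "genideal A (set ?gs) \<noteq> carrier A"
      using one_notin[of ?P] assms(2) by (auto simp: I_def)
  next
    fix i assume "i < length ?gs"
    then have i: "i < length fs" by simp
    define T where "T = {v \<in> ?P. \<pi> v \<in> set (take i fs)}"
    have T: "T \<subseteq> ?P" "\<pi> ` T = set (take i fs)"
      using assms(2) set_take_subset[of i fs] unfolding T_def by auto
    have gen: "genideal A (set (take i ?gs)) = I T"
      unfolding I_def T(2) by (simp add: take_map)
    obtain v where v: "v \<in> ?P" "fs ! i = \<pi> v" using assms(2) nth_mem[OF i] by auto
    have "fs ! i \<notin> set (take i fs)"
      using assms(1) i by (metis distinct_take id_take_nth_drop not_distinct_conv_prefix take_Suc_conv_app_nth)
    then have "v \<notin> T" using v unfolding T_def by auto
    interpret I: ideal "I T" A by (rule I[OF T(1)])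
    \<comment> \<open>Cosets of cosets: regularity modulo \<open>I T\<close> in \<open>A\<close> is regularity modulo \<open>K T\<close> in \<open>R\<close>.\<close>
    have "nonzerodivisor (A Quot I T) (I T +>\<^bsub>A\<^esub> (J +>\<^bsub>R\<^esub> \<pi> v))"
    proof (subst I.nonzerodivisor_Quot_iff)
      show "J +>\<^bsub>R\<^esub> \<pi> v \<in> carrier A" using \<pi>_carrier[OF v(1)] by (auto simp: carrier_A)
      show "\<forall>b\<in>carrier A. (J +>\<^bsub>R\<^esub> \<pi> v) \<otimes>\<^bsub>A\<^esub> b \<in> I T \<longrightarrow> b \<in> I T"
      proof (intro ballI impI)
        fix b assume "b \<in> carrier A" and prod: "(J +>\<^bsub>R\<^esub> \<pi> v) \<otimes>\<^bsub>A\<^esub> b \<in> I T"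
        then obtain p where p: "p \<in> carrier R" "b = J +>\<^bsub>R\<^esub> p" by (auto simp: carrier_A)
        have "(J +>\<^bsub>R\<^esub> \<pi> v) \<otimes>\<^bsub>A\<^esub> b = J +>\<^bsub>R\<^esub> (\<pi> v \<otimes>\<^bsub>R\<^esub> p)"
          unfolding A_def p(2) using ring_hom_mult[OF J.rcos_ring_hom \<pi>_carrier[OF v(1)] p(1)] by simp
        then have "\<pi> v \<otimes>\<^bsub>R\<^esub> p \<in> K T"
          using prod mem_I[OF T(1)] \<pi>_carrier[OF v(1)] p(1) by simp
        then have "p \<in> K T"
          using param_nonzerodivisor[OF T(1) v(1) \<open>v \<notin> T\<close>] p(1)
          by (simp add: K_def R_def poly_ring_simps)
        then show "b \<in> I T" using mem_I[OF T(1) p(1)] p(2) by simp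
      qed
    qed
    then show "nonzerodivisor (A Quot genideal A (set (take i ?gs))) (genideal A (set (take i ?gs)) +>\<^bsub>A\<^esub> ?gs ! i)"
      unfolding gen using v(2) i by simp
  qed

  have length_fs: "length fs = card ?P"
  proof -
    \<comment> \<open>Parameters are adapted products of degree one, and those are pairwise distinct.\<close>
    have "inj_on \<pi> ?P"
    proof (rule inj_onI)
      fix u v assume uv: "u \<in> ?P" "v \<in> ?P" "\<pi> u = \<pi> v"
      have "adapted (Poly_Mapping.single u 1) = adapted (Poly_Mapping.single v 1)"
        using uv adapted_add_param[of u 0] adapted_add_param[of v 0] by (simp add: adapted_zero)
      moreover have "Poly_Mapping.single w 1 \<in> monomials_le V 1" if "w \<in> ?P" for w
        using that by (simp add: monomials_le_def total_degree_single)
      ultimately have "Poly_Mapping.single u (1::nat) = Poly_Mapping.single v 1"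
        using uv by (intro inj_onD[OF inj_on_adapted[of 1]]) auto
      then show "u = v" by (metis keys_single one_neq_zero singleton_iff)
    qed
    then show ?thesis
      using distinct_card[OF assms(1)] assms(2) card_image by metis
  qed
  have chain: "k \<le> card (V - Z - T)"
    if "T \<subseteq> ?P" "\<And>i. i \<le> k \<Longrightarrow> primeideal (P i) R" "\<And>i. i < k \<Longrightarrow> P i \<subset> P (Suc i)" "K T \<subseteq> P 0"
    for T k P
    using that unfolding K_def R_def by (rule chain_length_le)

  show "krull_dim (R Quot J) = ereal (real (length fs))"
  proof (rule antisym)
    show "krull_dim (R Quot J) \<le> ereal (real (length fs))"
    proof (rule krull_dim_le_via_surjective_hom[OF J.rcos_ring_hom R.is_cring J.quotient_is_ring])
      show "(+>\<^bsub>R\<^esub>) J ` carrier R = carrier (R Quot J)" by (rule carrier_FactRing[symmetric])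
      have ker: "{r \<in> carrier R. J +>\<^bsub>R\<^esub> r = \<zero>\<^bsub>R Quot J\<^esub>} = K {}"
        using J.rcos_eq_self_iff J.Icarr unfolding zero_FactRing K_def R_def J_def by blast
      fix k P assume "\<And>i. i \<le> k \<Longrightarrow> primeideal (P i) R" "\<And>i. i < k \<Longrightarrow> P i \<subset> P (Suc i)"
        "{r \<in> carrier R. J +>\<^bsub>R\<^esub> r = \<zero>\<^bsub>R Quot J\<^esub>} \<subseteq> P 0"
      then show "k \<le> length fs" using chain[of "{}" k P] unfolding ker length_fs by simp
    qed
    show "ereal (real (length fs)) \<le> krull_dim (R Quot J)"
      using A.krull_dim_ge_length_regular_sequence regular unfolding A_def by fastforce
  qed

  have gen: "genideal A (set ?gs) = I ?P" using assms(2) by (simp add: I_def)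
  interpret IP: ideal "I ?P" A by (rule I) simp
  have "krull_dim (A Quot I ?P) = 0"
  proof (rule antisym)
    show "krull_dim (A Quot I ?P) \<ge> 0"
      by (rule A.krull_dim_Quot_nonneg[OF IP.is_ideal one_notin]) simp
    define h where "h = (+>\<^bsub>A\<^esub>) (I ?P) \<circ> (+>\<^bsub>R\<^esub>) J"
    have h: "h \<in> Ring.ring_hom R (A Quot I ?P)"
      unfolding h_def using J.rcos_ring_hom IP.rcos_ring_hom unfolding A_def by (rule ring_hom_trans)
    have "krull_dim (A Quot I ?P) \<le> ereal (real 0)"
    proof (rule krull_dim_le_via_surjective_hom[OF h R.is_cring IP.quotient_is_ring])
      show "h ` carrier R = carrier (A Quot I ?P)"
        unfolding h_def carrier_FactRing[of A] carrier_A by (simp add: image_comp)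
      have "h r = \<zero>\<^bsub>A Quot I ?P\<^esub> \<longleftrightarrow> r \<in> K ?P" if "r \<in> carrier R" for r
      proof -
        have "J +>\<^bsub>R\<^esub> r \<in> carrier A" using that by (auto simp: carrier_A)
        then show ?thesis
          using mem_I[OF subset_refl that] IP.rcos_eq_self_iff by (simp add: h_def zero_FactRing)
      qed
      moreover have "K ?P \<subseteq> carrier R"
        unfolding K_def using ideal.Icarr[OF R.genideal_ideal[OF rel[OF subset_refl]]] by blast
      ultimately have ker: "{r \<in> carrier R. h r = \<zero>\<^bsub>A Quot I ?P\<^esub>} = K ?P" by blast
      fix k P assume "\<And>i. i \<le> k \<Longrightarrow> primeideal (P i) R" "\<And>i. i < k \<Longrightarrow> P i \<subset> P (Suc i)"
        "{r \<in> carrier R. h r = \<zero>\<^bsub>A Quot I ?P\<^esub>} \<subseteq> P 0"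
      then show "k \<le> 0" using chain[of ?P k P] unfolding ker by simp
    qed
    then show "krull_dim (A Quot I ?P) \<le> 0" by (simp add: zero_ereal_def)
  qed
  then show "krull_dim (R Quot J Quot genideal (R Quot J) (set ?gs)) = 0"
    unfolding A_def[symmetric] gen .
qed

end

section \<open>The anti-diagonal of the generic commutator\<close>

lemma homogeneous_mult: "homogeneous i p \<Longrightarrow> homogeneous j q \<Longrightarrow> homogeneous (i + j) (p * q)"
  using Poly_Mapping.keys_mult[of p q] by (fastforce simp: homogeneous_def total_degree_add)

lemma homogeneous_diff: "homogeneous d p \<Longrightarrow> homogeneous d q \<Longrightarrow> homogeneous d (p - q)"
  using Poly_Mapping.keys_diff[of p q] by (fastforce simp: homogeneous_def)

lemma homogeneous_sum: "(\<And>i. i \<in> A \<Longrightarrow> homogeneous d (f i)) \<Longrightarrow> homogeneous d (sum f A)"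
  using Poly_Mapping.keys_sum[of f A] by (fastforce simp: homogeneous_def)

lemma homogeneous_indet: "homogeneous 1 (indet v)"
  by (simp add: homogeneous_def indet_def total_degree_single)

lemma comm_entry_eq:
  assumes "i \<in> {1..n}" "j \<in> {1..n}"
  shows "(comm_entry n i j :: (mvar, 'k::field) mpoly)
    = (\<Sum>k=1..n. xvar i k * yvar k j) - (\<Sum>k=1..n. yvar i k * xvar k j)"
proof -
  have "i - 1 < n" "j - 1 < n" "Suc (i - 1) = i" "Suc (j - 1) = j" using assms by auto
  then show ?thesis
    unfolding comm_entry_def commutator_def generic_X_def generic_Y_def
    by (simp add: scalar_prod_def sum.atLeast1_atMost_eq lessThan_atLeast0)
qed

text \<open>
The variable at which a parameter is indexed is its leading one: it becomes the parameter after a linear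
change of coordinates that fixes the first column of \<open>Y\<close>.
\<close>

definition param :: "nat \<Rightarrow> mvar \<Rightarrow> (mvar, 'k::field) mpoly" where
  "param n v = (case v of
     XVar i j \<Rightarrow> if i = 1 then xvar 1 j - yvar (n - j + 1) 1 else xvar i j
   | YVar i j \<Rightarrow> yvar i j)"

text \<open>
The sign makes the quadric attached to \<open>y\<^sub>i\<^sub>1\<close> monic.
\<close>

definition neg_entry :: "nat \<Rightarrow> mvar \<Rightarrow> (mvar, 'k::field) mpoly" where
  "neg_entry n v = (case v of XVar i j \<Rightarrow> 0 | YVar i j \<Rightarrow> - comm_entry n i (n + 1 - i))"

definition first_column :: "nat \<Rightarrow> mvar set" where
  "first_column n = {YVar i 1 | i. i \<in> {1..n}}"

lemma XVar_in_mvars_iff: "XVar i j \<in> mvars n \<longleftrightarrow> i \<in> {1..n} \<and> j \<in> {1..n}"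
  and YVar_in_mvars_iff: "YVar i j \<in> mvars n \<longleftrightarrow> i \<in> {1..n} \<and> j \<in> {1..n}"
  by (auto simp: mvars_def)

lemma finite_mvars: "finite (mvars n)"
proof -
  have "mvars n = case_prod XVar ` ({1..n} \<times> {1..n}) \<union> case_prod YVar ` ({1..n} \<times> {1..n})"
    by (auto simp: mvars_def)
  then show ?thesis by simp
qed

lemma parameters_eq: "parameters n = param n ` (mvars n - first_column n)" (is "?L = ?R")
proof
  show "?L \<subseteq> ?R"
  proof
    fix f :: "(mvar, 'a) mpoly" assume "f \<in> ?L"
    then consider i j where "i \<in> {2..n}" "j \<in> {1..n}" "f = xvar i j"
      | i j where "i \<in> {1..n}" "j \<in> {2..n}" "f = yvar i j"
      | j where "j \<in> {1..n}" "f = xvar 1 j - yvar (n - j + 1) 1"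
      unfolding parameters_def by blast
    then show "f \<in> ?R"
    proof cases
      case 1
      then show ?thesis
        by (intro image_eqI[of _ _ "XVar i j"]) (auto simp: param_def mvars_def first_column_def)
    next
      case 2
      then show ?thesis
        by (intro image_eqI[of _ _ "YVar i j"]) (auto simp: param_def mvars_def first_column_def)
    next
      case 3
      then show ?thesis
        by (intro image_eqI[of _ _ "XVar 1 j"]) (auto simp: param_def mvars_def first_column_def)
    qed
  qed
  show "?R \<subseteq> ?L"
  proof (rule image_subsetI)
    fix v assume v: "v \<in> mvars n - first_column n"
    show "param n v \<in> ?L"
    proof (cases v)
      case (XVar i j)
      then have ij: "i \<in> {1..n}" "j \<in> {1..n}" using v by (auto simp: XVar_in_mvars_iff)
      show ?thesis
      proof (cases "i = 1")
        case True
        then have "param n v = xvar 1 j - yvar (n - j + 1) 1" using XVar by (simp add: param_def)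
        then show ?thesis unfolding parameters_def using ij by blast
      next
        case False
        then have "param n v = xvar i j" "i \<in> {2..n}" using XVar ij by (auto simp: param_def)
        then show ?thesis unfolding parameters_def using ij by blast
      qed
    next
      case (YVar i j)
      then have "j \<in> {2..n}" "i \<in> {1..n}" using v by (auto simp: YVar_in_mvars_iff first_column_def)
      moreover have "param n v = yvar i j" using YVar by (simp add: param_def)
      ultimately show ?thesis unfolding parameters_def by blast
    qed
  qed
qed

text \<open>
Put \<open>j = n + 1 - i\<close>. In the negated entry \<open>\<Sum> y\<^sub>i\<^sub>k x\<^sub>k\<^sub>j - \<Sum> x\<^sub>i\<^sub>k y\<^sub>k\<^sub>j\<close> the term \<open>y\<^sub>i\<^sub>1 x\<^sub>1\<^sub>j\<close> is
\<open>y\<^sub>i\<^sub>1\<^sup>2\<close> plus a multiple of the parameter \<open>x\<^sub>1\<^sub>j - y\<^sub>i\<^sub>1\<close>, and \<open>y\<^sub>i\<^sub>k\<close> is a parameter for \<open>k \<ge> 2\<close>. In the second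
sum \<open>x\<^sub>i\<^sub>k\<close> is a parameter if \<open>i \<ge> 2\<close>; if \<open>i = 1\<close> then \<open>j = n \<ge> 2\<close>, and \<open>y\<^sub>k\<^sub>j\<close> is one.
\<close>

lemma monic_quadratic_system_neg_entry:
  assumes n: "n \<ge> 2"
  shows "monic_quadratic_system (mvars n) (first_column n)
    (param n :: mvar \<Rightarrow> (mvar, 'k::field) mpoly) (neg_entry n)"
proof
  let ?V = "mvars n" and ?Z = "first_column n"
  show "finite ?V" by (rule finite_mvars)
  show "?Z \<subseteq> ?V" using n by (auto simp: first_column_def mvars_def)
  have indet: "(indet v :: (mvar, 'k) mpoly) \<in> polys_le ?V 1" if "v \<in> ?V" for v
    using that by (simp only: indet_in_polys_le_iff)
  show "(param n v :: (mvar, 'k) mpoly) \<in> polys_le ?V 1" if "v \<in> ?V - ?Z" for v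
  proof (cases v)
    case (XVar i j)
    then have j: "j \<in> {1..n}" "n - j + 1 \<in> {1..n}" using that by (auto simp: XVar_in_mvars_iff)
    show ?thesis
    proof (cases "i = 1")
      case True
      have "(xvar 1 j - yvar (n - j + 1) 1 :: (mvar, 'k) mpoly) \<in> polys_le ?V 1"
        using j n by (intro mp.subspace_diff[OF subspace_polys_le] indet)
          (simp_all add: XVar_in_mvars_iff YVar_in_mvars_iff)
      then show ?thesis using XVar True by (simp add: param_def)
    next
      case False
      then show ?thesis using XVar that indet[of v] by (simp add: param_def)
    qed
  next
    case (YVar i j)
    then show ?thesis using that indet[of v] by (simp add: param_def del: One_nat_def)
  qed
  show "(indet v :: (mvar, 'k) mpoly) - param n v \<in> mp.span (indet ` ?Z)" if v: "v \<in> ?V - ?Z" for v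
  proof (cases v)
    case (XVar i j)
    have "yvar (n - j + 1) 1 \<in> mp.span ((indet :: mvar \<Rightarrow> (mvar, 'k) mpoly) ` ?Z)"
      using v XVar by (intro mp.span_base imageI) (auto simp: first_column_def XVar_in_mvars_iff)
    then show ?thesis using XVar by (auto simp: param_def mp.span_zero)
  next
    case (YVar i j)
    then show ?thesis by (simp add: param_def mp.span_zero)
  qed
  show "(neg_entry n z :: (mvar, 'k) mpoly) - indet z ^ 2
      \<in> mp.span {param n v * q | v q. v \<in> ?V - ?Z \<and> q \<in> polys_le ?V 1}" (is "_ \<in> mp.span ?G")
    if "z \<in> ?Z" for z
  proof -
    have G: "param n v * indet u \<in> mp.span ?G" if "v \<in> ?V - ?Z" "u \<in> ?V" for u v
      using that(1) indet[OF that(2)]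
      by (intro mp.span_base CollectI exI[of _ v] exI[of _ "indet u"] conjI refl)
    obtain i where i: "i \<in> {1..n}" "z = YVar i 1" using \<open>z \<in> ?Z\<close> by (auto simp: first_column_def)
    define j where "j = n + 1 - i"
    have j: "j \<in> {1..n}" "n - j + 1 = i" using i by (auto simp: j_def)
    have split: "{1..n} = insert 1 {2..n}" using n by auto
    have "(neg_entry n z :: (mvar, 'k) mpoly) = (\<Sum>k=1..n. yvar i k * xvar k j) - (\<Sum>k=1..n. xvar i k * yvar k j)"
      using comm_entry_eq[OF i(1) j(1), where 'k = 'k] i(2) by (simp add: neg_entry_def j_def)
    also have "(\<Sum>k=1..n. yvar i k * xvar k j :: (mvar, 'k) mpoly)
      = yvar i 1 * xvar 1 j + (\<Sum>k=2..n. yvar i k * xvar k j)"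
      unfolding split by simp
    also have "(yvar i 1 * xvar 1 j :: (mvar, 'k) mpoly) = param n (XVar 1 j) * yvar i 1 + yvar i 1 ^ 2"
      by (simp only: param_def mvar.case j(2) if_True) (simp add: algebra_simps power2_eq_square)
    finally have eq: "(neg_entry n z :: (mvar, 'k) mpoly) - indet z ^ 2
      = param n (XVar 1 j) * yvar i 1 + (\<Sum>k=2..n. yvar i k * xvar k j) - (\<Sum>k=1..n. xvar i k * yvar k j)"
      using i(2) by (simp add: algebra_simps)
    have "param n (XVar 1 j) * yvar i 1 \<in> mp.span ?G"
      using i j n by (intro G) (auto simp: mvars_def first_column_def)
    moreover have "(\<Sum>k=2..n. yvar i k * xvar k j) \<in> mp.span ?G"
    proof (rule mp.span_sum)
      fix k assume "k \<in> {2..n}"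
      then have "param n (YVar i k) * xvar k j \<in> mp.span ?G"
        using i j by (intro G) (auto simp: mvars_def first_column_def)
      then show "yvar i k * xvar k j \<in> mp.span ?G" by (simp add: param_def)
    qed
    moreover have "(\<Sum>k=1..n. xvar i k * yvar k j) \<in> mp.span ?G"
    proof (rule mp.span_sum)
      fix k assume k: "k \<in> {1..n}"
      show "xvar i k * yvar k j \<in> mp.span ?G"
      proof (cases "i = 1")
        case True
        then have "param n (YVar k j) * xvar i k \<in> mp.span ?G"
          using i j k n by (intro G) (auto simp: mvars_def first_column_def)
        then show ?thesis by (simp add: param_def mult.commute)
      next
        case False
        then have "param n (XVar i k) * yvar k j \<in> mp.span ?G"
          using i j k by (intro G) (auto simp: mvars_def first_column_def)
        then show ?thesis using False by (simp add: param_def)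
      qed
    qed
    ultimately show ?thesis unfolding eq by (intro mp.span_diff mp.span_add)
  qed
qed

lemma genideal_uminus_image:
  assumes S: "S \<subseteq> carrier (poly_ring V :: ('v, 'k::field) mpoly ring)"
  shows "genideal (poly_ring V) (uminus ` S) = genideal (poly_ring V) S"
proof -
  interpret R: cring "poly_ring V :: ('v, 'k) mpoly ring" by (rule cring_poly_ring)
  have sub: "genideal (poly_ring V) (uminus ` S) \<subseteq> genideal (poly_ring V) S"
    if S: "S \<subseteq> carrier (poly_ring V)" for S :: "('v, 'k) mpoly set"
  proof (rule R.genideal_minimal[OF R.genideal_ideal[OF S]], rule image_subsetI)
    fix p assume "p \<in> S"
    then show "- p \<in> genideal (poly_ring V) S"
      using mp.subspace_neg[OF ideal_poly_ring_subspace[OF R.genideal_ideal[OF S]]]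
        R.genideal_self[OF S] by blast
  qed
  have "uminus ` S \<subseteq> carrier (poly_ring V)"
    using S mp.subspace_neg[OF subspace_poly_ring] by blast
  from sub[OF this] sub[OF S] show ?thesis by (simp add: image_image)
qed

theorem theorem5p2:
  fixes n :: nat
    and fs :: "(mvar, 'k::field) mpoly list"
  defines "R \<equiv> (poly_ring (mvars n) :: (mvar, 'k) mpoly ring)"
    and "J \<equiv> (antidiag_ideal n :: (mvar, 'k) mpoly set)"
  assumes "n \<ge> 3"
    and "distinct fs"
    and "set fs = parameters n"
  shows "hsop (mvars n) J (map (\<lambda>f. J +>\<^bsub>R\<^esub> f) fs) \<and>
         regular_sequence (R Quot J) (map (\<lambda>f. J +>\<^bsub>R\<^esub> f) fs)"
proof -
  interpret S: monic_quadratic_system "mvars n" "first_column n"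
    "param n :: mvar \<Rightarrow> (mvar, 'k) mpoly" "neg_entry n"
    by (rule monic_quadratic_system_neg_entry) (use \<open>n \<ge> 3\<close> in simp)
  let ?C = "{comm_entry n i (n + 1 - i) | i. i \<in> {1..n}} :: (mvar, 'k) mpoly set"
  have C: "?C = (\<lambda>i. comm_entry n i (n + 1 - i)) ` {1..n}" by auto
  have Z: "first_column n = (\<lambda>i. YVar i 1) ` {1..n}" by (auto simp: first_column_def)
  have "S.relations {} = neg_entry n ` first_column n" by (simp add: S.relations_def)
  also have "\<dots> = neg_entry n ` (\<lambda>i. YVar i 1) ` {1..n}" unfolding Z ..
  also have "\<dots> = uminus ` ?C" unfolding C by (simp add: image_image neg_entry_def)
  finally have rel: "S.relations {} = uminus ` ?C" .
  have "?C = uminus ` S.relations {}" unfolding rel by (simp add: image_image)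
  then have C_carrier: "?C \<subseteq> carrier R"
    using S.relations_subset_carrier[of "{}"] mp.subspace_neg[OF subspace_poly_ring]
    unfolding R_def by auto
  have J_eq: "J = genideal (poly_ring (mvars n)) (S.relations {})"
    unfolding J_def antidiag_ideal_def rel
    by (rule genideal_uminus_image[symmetric]) (use C_carrier in \<open>simp add: R_def\<close>)
  have fs: "set fs = param n ` (mvars n - first_column n)"
    using \<open>set fs = parameters n\<close> parameters_eq by simp
  have "homogeneous 2 p" if p: "p \<in> ?C" for p
  proof -
    obtain i where i: "i \<in> {1..n}" "p = comm_entry n i (n + 1 - i)" using p by blast
    have "homogeneous 2 (indet u * indet v :: (mvar, 'k) mpoly)" for u v
      using homogeneous_mult[OF homogeneous_indet homogeneous_indet, of u v] by (simp add: numeral_2_eq_2)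
    moreover have "n + 1 - i \<in> {1..n}" using i(1) by auto
    ultimately show ?thesis
      unfolding i(2) comm_entry_eq[OF i(1) \<open>n + 1 - i \<in> {1..n}\<close>]
      by (intro homogeneous_diff homogeneous_sum)
  qed
  then have "homogeneous_ideal (mvars n) J"
    unfolding homogeneous_ideal_def J_def antidiag_ideal_def
    using C_carrier by (intro exI[of _ ?C]) (auto simp: R_def)
  moreover have "\<exists>d>0. \<exists>p\<in>carrier R. homogeneous d p \<and> g = J +>\<^bsub>R\<^esub> p"
    if g: "g \<in> set (map (\<lambda>f. J +>\<^bsub>R\<^esub> f) fs)" for g
  proof -
    obtain v where v: "v \<in> mvars n - first_column n" "g = J +>\<^bsub>R\<^esub> param n v"
      using g fs by auto
    have "homogeneous 1 (param n v :: (mvar, 'k) mpoly)"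
      by (auto simp: param_def split: mvar.split intro!: homogeneous_diff homogeneous_indet[unfolded One_nat_def])
    moreover have "param n v \<in> carrier R"
      unfolding R_def using S.param_deg[OF v(1)] by (rule subsetD[OF polys_le_subset_carrier])
    ultimately show ?thesis using v(2) by (intro exI[of _ 1]) auto
  qed
  ultimately show ?thesis
    unfolding hsop_def Let_def
    using S.regular_sequence_params[OF \<open>distinct fs\<close> fs] S.krull_dim_Quot_relations[OF \<open>distinct fs\<close> fs]
      S.krull_dim_Quot_params[OF \<open>distinct fs\<close> fs]
    unfolding J_eq[symmetric] R_def by auto
qed

end
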